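(* Let $L_{ij}$ and $R_{ij}$ $(1\leq i,j\leq n)$ be self-adjoint and strictly positive operators, respectively, on a Hilbert space, and let $p_j$ $(1\leq j\leq n)$ be positive numbers. If $f$ is operator convex, with perspective function $g$ and associated non-commutative $f$-divergence functional $\Theta$, then $$\sum_{i=1}^{n}g(L_i,R_i)\leq\sum_{i=1}^{n}p_i\,\Theta(\widetilde{L}^i,\widetilde{R}^i),$$ where $L_i=\sum_{j=1}^{n}p_jL_{ij}$, $R_i=\sum_{j=1}^{n}p_jR_{ij}$, $\widetilde{L}^i=(L_{i1},\dots,L_{in})$ and $\widetilde{R}^i=(R_{i1},\dots,R_{in})$.
   Context: An operator is strictly positive if it is positive and invertible; $X\le Y$ means $Y-X$ is positive. A continuous real function $f$ on an interval $J$ is operator convex if $f(\lambda X+(1-\lambda)Y)\le\lambda f(X)+(1-\lambda)f(Y)$ for all self-adjoint operators $X,Y$ with spectra in $J$ and all $\lambda\in[0,1]$. For $f:[0,\infty)\to\mathbb{R}$, the perspective function of $f$ is $g(L,R)=R^{1/2}f(R^{-1/2}LR^{-1/2})R^{1/2}$ for $L$ self-adjoint and $R$ strictly positive; for $n$-tuples $\widetilde{L}=(L_1,\dots,L_n)$ and $\widetilde{R}=(R_1,\dots,R_n)$ of self-adjoint and strictly positive operators, respectively, $\Theta(\widetilde{L},\widetilde{R})=\sum_{i=1}^{n}R_i^{1/2}f(R_i^{-1/2}L_iR_i^{-1/2})R_i^{1/2}$.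
   Formalization: The printed inequality is false, so the tuples are taken as L̃^i=(L_{1i},…,L_{ni}) and R̃^i=(R_{1i},…,R_{ni}); also each R_{ij}^{-1/2}L_{ij}R_{ij}^{-1/2} is assumed to have spectrum in [0,∞), the domain of f. *)

theory Defs
  imports "HOL-Analysis.Analysis" "HOL-Computational_Algebra.Polynomial"
begin

section \<open>Complex Hilbert spaces\<close>

text \<open>A complex Hilbert space carries an underlying real Hilbert space (real inner product = real
part of the complex one), so the metric and real-linear library infrastructure applies. The inner
product is conjugate-linear in its first argument.\<close>

class chilbert_space = real_inner + complete_space +
  fixes scaleC :: "complex \<Rightarrow> 'a \<Rightarrow> 'a" (infixr "*\<^sub>C" 75)
    and cinner :: "'a \<Rightarrow> 'a \<Rightarrow> complex"
  assumes scaleC_of_real: "complex_of_real r *\<^sub>C x = r *\<^sub>R x"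
    and scaleC_add_right: "c *\<^sub>C (x + y) = c *\<^sub>C x + c *\<^sub>C y"
    and scaleC_add_left: "(c + d) *\<^sub>C x = c *\<^sub>C x + d *\<^sub>C x"
    and scaleC_scaleC: "c *\<^sub>C d *\<^sub>C x = (c * d) *\<^sub>C x"
    and cinner_commute: "cinner x y = cnj (cinner y x)"
    and cinner_add_left: "cinner (x + y) z = cinner x z + cinner y z"
    and cinner_scaleC_left: "cinner (c *\<^sub>C x) y = cnj c * cinner x y"
    and inner_eq_Re_cinner: "x \<bullet> y = Re (cinner x y)"

lemma cinner_add_right: "cinner x (y + z) = cinner x y + cinner x z"
  for x y z :: "'a::chilbert_space"
  by (metis cinner_add_left cinner_commute complex_cnj_add)

lemma cinner_scaleC_right: "cinner x (c *\<^sub>C y) = c * cinner x y"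
  for x y :: "'a::chilbert_space"
  by (metis cinner_scaleC_left cinner_commute complex_cnj_cnj complex_cnj_mult)

lemma cinner_self: "cinner x x = complex_of_real ((norm x)\<^sup>2)"
  for x :: "'a::chilbert_space"
proof (rule complex_eqI)
  show "Re (cinner x x) = Re (complex_of_real ((norm x)\<^sup>2))"
    by (simp flip: inner_eq_Re_cinner add: power2_norm_eq_inner)
  have "Im (cinner x x) = Im (cnj (cinner x x))"
    using cinner_commute[of x x] by simp
  then show "Im (cinner x x) = Im (complex_of_real ((norm x)\<^sup>2))"
    by simp
qed

lemma cinner_ext:
  fixes x y :: "'a::chilbert_space"
  assumes "\<And>z. cinner z x = cinner z y"
  shows "x = y"
proof -
  have "(x - y) \<bullet> x = (x - y) \<bullet> y"
    using assms by (simp add: inner_eq_Re_cinner)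
  then have "(x - y) \<bullet> (x - y) = 0"
    by (simp add: inner_diff_right)
  then show ?thesis by simp
qed

lemma norm_scaleC: "norm (c *\<^sub>C x) = cmod c * norm x"
  for x :: "'a::chilbert_space"
proof -
  have "complex_of_real ((norm (c *\<^sub>C x))\<^sup>2) = cnj c * (c * cinner x x)"
    by (subst cinner_self[symmetric]) (simp only: cinner_scaleC_left cinner_scaleC_right mult.left_commute)
  also have "\<dots> = (c * cnj c) * cinner x x"
    by (metis mult.assoc mult.commute)
  also have "\<dots> = complex_of_real ((cmod c * norm x)\<^sup>2)"
    by (simp only: complex_norm_square[symmetric] cinner_self power_mult_distrib of_real_mult
        of_real_power)
  finally have "(norm (c *\<^sub>C x))\<^sup>2 = (cmod c * norm x)\<^sup>2"
    by (simp only: of_real_eq_iff)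
  then show ?thesis by (simp add: power2_eq_iff_nonneg)
qed

lemma bounded_linear_scaleC: "bounded_linear (\<lambda>x::'a::chilbert_space. c *\<^sub>C x)"
proof (rule bounded_linear_intro[where K = "cmod c"])
  fix r and x :: 'a
  show "c *\<^sub>C (r *\<^sub>R x) = r *\<^sub>R (c *\<^sub>C x)"
    by (simp add: scaleC_scaleC mult.commute flip: scaleC_of_real)
qed (simp_all add: scaleC_add_right norm_scaleC mult.commute)


section \<open>The Hilbert space of square-summable complex sequences\<close>

definition square_summable :: "(nat \<Rightarrow> complex) \<Rightarrow> bool" where
  "square_summable x \<longleftrightarrow> summable (\<lambda>n. (cmod (x n))\<^sup>2)"

lemma square_summable_add:
  assumes "square_summable x" "square_summable y"
  shows "square_summable (\<lambda>n. x n + y n)"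
  unfolding square_summable_def
proof (rule summable_comparison_test')
  show "summable (\<lambda>n. 2 * (cmod (x n))\<^sup>2 + 2 * (cmod (y n))\<^sup>2)"
    using assms unfolding square_summable_def by (intro summable_add summable_mult)
next
  fix n
  have "(cmod (x n + y n))\<^sup>2 \<le> (cmod (x n) + cmod (y n))\<^sup>2"
    by (intro power_mono norm_triangle_ineq) simp
  also have "\<dots> \<le> 2 * (cmod (x n))\<^sup>2 + 2 * (cmod (y n))\<^sup>2"
    using sum_squares_bound[of "cmod (x n)" "cmod (y n)"] by (simp add: power2_sum)
  finally show "norm ((cmod (x n + y n))\<^sup>2) \<le> 2 * (cmod (x n))\<^sup>2 + 2 * (cmod (y n))\<^sup>2"
    by simp
qed

lemma square_summable_scale:
  assumes "square_summable x"
  shows "square_summable (\<lambda>n. c * x n)"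
  using assms summable_mult[of "\<lambda>n. (cmod (x n))\<^sup>2" "(cmod c)\<^sup>2"]
  by (simp add: square_summable_def norm_mult power_mult_distrib)

lemma square_summable_diff:
  assumes "square_summable x" "square_summable y"
  shows "square_summable (\<lambda>n. x n - y n)"
  using square_summable_add[OF assms(1) square_summable_scale[OF assms(2), of "-1"]] by simp

lemma square_summable_inner:
  assumes "square_summable x" "square_summable y"
  shows "summable (\<lambda>n. cnj (x n) * y n)"
proof (rule summable_comparison_test')
  show "summable (\<lambda>n. (cmod (x n))\<^sup>2 + (cmod (y n))\<^sup>2)"
    using assms unfolding square_summable_def by (rule summable_add)
next
  fix n
  have "2 * (cmod (x n) * cmod (y n)) \<le> (cmod (x n))\<^sup>2 + (cmod (y n))\<^sup>2"
    using sum_squares_bound[of "cmod (x n)" "cmod (y n)"] by (simp add: mult.assoc)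
  moreover have "0 \<le> cmod (x n) * cmod (y n)" by simp
  ultimately show "norm (cnj (x n) * y n) \<le> (cmod (x n))\<^sup>2 + (cmod (y n))\<^sup>2"
    unfolding norm_mult complex_mod_cnj by linarith
qed

typedef ell2 = "{x :: nat \<Rightarrow> complex. square_summable x}"
  morphisms ell2_coord Abs_ell2
  by (rule exI[of _ "\<lambda>_. 0"]) (simp add: square_summable_def)

setup_lifting type_definition_ell2

lift_definition ell2_scale :: "complex \<Rightarrow> ell2 \<Rightarrow> ell2" is "\<lambda>c x n. c * x n"
  by (rule square_summable_scale)

lift_definition ell2_cinner :: "ell2 \<Rightarrow> ell2 \<Rightarrow> complex" is "\<lambda>x y. \<Sum>n. cnj (x n) * y n" .

lemma ell2_cinner_scale: "ell2_cinner (ell2_scale c x) y = cnj c * ell2_cinner x y"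
  by transfer (simp add: mult.assoc suminf_mult square_summable_inner)

lemma ell2_cinner_commute: "ell2_cinner x y = cnj (ell2_cinner y x)"
proof transfer
  fix x y :: "nat \<Rightarrow> complex"
  assume "square_summable x" "square_summable y"
  from summable_sums[OF square_summable_inner[OF this(2,1)]]
  have "(\<lambda>n. cnj (cnj (y n) * x n)) sums cnj (\<Sum>n. cnj (y n) * x n)"
    by (simp only: sums_cnj)
  then have "(\<lambda>n. cnj (x n) * y n) sums cnj (\<Sum>n. cnj (y n) * x n)"
    by (simp add: mult.commute)
  then show "(\<Sum>n. cnj (x n) * y n) = cnj (\<Sum>n. cnj (y n) * x n)"
    by (simp add: sums_unique[symmetric])
qed

lemma ell2_square_sums: "(\<lambda>n. (cmod (ell2_coord x n))\<^sup>2) sums Re (ell2_cinner x x)"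
proof -
  have s: "summable (\<lambda>n. (cmod (ell2_coord x n))\<^sup>2)"
    using ell2_coord[of x] by (simp add: square_summable_def)
  have "(\<lambda>n. complex_of_real ((cmod (ell2_coord x n))\<^sup>2)) sums
      complex_of_real (\<Sum>n. (cmod (ell2_coord x n))\<^sup>2)"
    using summable_sums[OF s] by (simp only: sums_of_real_iff)
  then have "(\<lambda>n. cnj (ell2_coord x n) * ell2_coord x n) sums
      complex_of_real (\<Sum>n. (cmod (ell2_coord x n))\<^sup>2)"
    by (simp only: complex_norm_square mult.commute)
  then have "ell2_cinner x x = complex_of_real (\<Sum>n. (cmod (ell2_coord x n))\<^sup>2)"
    by (simp add: ell2_cinner.rep_eq sums_unique[symmetric])
  then show ?thesis using summable_sums[OF s] by simp
qed

instantiation ell2 :: real_inner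
begin

lift_definition zero_ell2 :: ell2 is "\<lambda>_. 0" by (simp add: square_summable_def)
lift_definition plus_ell2 :: "ell2 \<Rightarrow> ell2 \<Rightarrow> ell2" is "\<lambda>x y n. x n + y n"
  by (rule square_summable_add)
lift_definition minus_ell2 :: "ell2 \<Rightarrow> ell2 \<Rightarrow> ell2" is "\<lambda>x y n. x n - y n"
  by (rule square_summable_diff)
lift_definition uminus_ell2 :: "ell2 \<Rightarrow> ell2" is "\<lambda>x n. - x n"
  by (simp add: square_summable_def)

definition scaleR_ell2 :: "real \<Rightarrow> ell2 \<Rightarrow> ell2" where "scaleR_ell2 r = ell2_scale (of_real r)"
definition inner_ell2 :: "ell2 \<Rightarrow> ell2 \<Rightarrow> real" where "inner_ell2 x y = Re (ell2_cinner x y)"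
definition norm_ell2 :: "ell2 \<Rightarrow> real" where "norm_ell2 x = sqrt (x \<bullet> x)"
definition sgn_ell2 :: "ell2 \<Rightarrow> ell2" where "sgn_ell2 x = inverse (norm x) *\<^sub>R x"
definition dist_ell2 :: "ell2 \<Rightarrow> ell2 \<Rightarrow> real" where "dist_ell2 x y = norm (x - y)"
definition uniformity_ell2 :: "(ell2 \<times> ell2) filter" where
  "uniformity_ell2 = (INF e\<in>{0<..}. principal {(x, y). dist x y < e})"
definition open_ell2 :: "ell2 set \<Rightarrow> bool" where
  "open_ell2 U \<longleftrightarrow> (\<forall>x\<in>U. eventually (\<lambda>(x', y). x' = x \<longrightarrow> y \<in> U) uniformity)"

lemma ell2_cinner_add: "ell2_cinner (x + y) z = ell2_cinner x z + ell2_cinner y z"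
  by transfer (simp add: distrib_right suminf_add square_summable_inner)

instance
proof
  fix x y z :: ell2 and r s :: real
  show "x + y + z = x + (y + z)" by transfer (simp add: add.assoc)
  show "x + y = y + x" by transfer (simp add: add.commute)
  show "0 + x = x" by transfer simp
  show "- x + x = 0" by transfer simp
  show "x - y = x + - y" by transfer simp
  show "r *\<^sub>R (x + y) = r *\<^sub>R x + r *\<^sub>R y"
    unfolding scaleR_ell2_def by transfer (simp add: algebra_simps)
  show "(r + s) *\<^sub>R x = r *\<^sub>R x + s *\<^sub>R x"
    unfolding scaleR_ell2_def by transfer (simp add: algebra_simps)
  show "r *\<^sub>R s *\<^sub>R x = (r * s) *\<^sub>R x"
    unfolding scaleR_ell2_def by transfer (simp add: algebra_simps)
  show "1 *\<^sub>R x = x"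
    unfolding scaleR_ell2_def by transfer simp
  show "dist x y = norm (x - y)" by (rule dist_ell2_def)
  show "sgn x = inverse (norm x) *\<^sub>R x" by (rule sgn_ell2_def)
  show "uniformity = (INF e\<in>{0<..}. principal {(x::ell2, y). dist x y < e})"
    by (rule uniformity_ell2_def)
  show "open U = (\<forall>x\<in>U. eventually (\<lambda>(x', y). x' = x \<longrightarrow> y \<in> U) uniformity)" for U :: "ell2 set"
    by (rule open_ell2_def)
  show "norm x = sqrt (x \<bullet> x)" by (rule norm_ell2_def)
  show "x \<bullet> y = y \<bullet> x"
    unfolding inner_ell2_def by (subst ell2_cinner_commute) simp
  show "(x + y) \<bullet> z = x \<bullet> z + y \<bullet> z"
    by (simp add: inner_ell2_def ell2_cinner_add)
  show "(r *\<^sub>R x) \<bullet> y = r * (x \<bullet> y)"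
    by (simp add: inner_ell2_def scaleR_ell2_def ell2_cinner_scale)
  have sq: "(\<lambda>n. (cmod (ell2_coord x n))\<^sup>2) sums (x \<bullet> x)"
    unfolding inner_ell2_def by (rule ell2_square_sums)
  show "0 \<le> x \<bullet> x"
    using sums_le[OF _ sums_zero sq] by simp
  show "(x \<bullet> x = 0) = (x = 0)"
  proof
    assume "x \<bullet> x = 0"
    with sq have "\<forall>n. (cmod (ell2_coord x n))\<^sup>2 = 0"
      using suminf_eq_zero_iff[of "\<lambda>n. (cmod (ell2_coord x n))\<^sup>2"]
      by (simp add: sums_iff)
    then show "x = 0"
      by (intro ell2_coord_inject[THEN iffD1]) (auto simp: zero_ell2.rep_eq)
  next
    assume "x = 0"
    then show "x \<bullet> x = 0" by (simp add: inner_ell2_def ell2_cinner.rep_eq zero_ell2.rep_eq)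
  qed
qed

end

instantiation ell2 :: chilbert_space
begin

definition scaleC_ell2 :: "complex \<Rightarrow> ell2 \<Rightarrow> ell2" where "scaleC_ell2 = ell2_scale"
definition cinner_ell2 :: "ell2 \<Rightarrow> ell2 \<Rightarrow> complex" where "cinner_ell2 = ell2_cinner"

instance
proof
  fix x y z :: ell2 and r :: real and c d :: complex
  show "complex_of_real r *\<^sub>C x = r *\<^sub>R x" by (simp add: scaleC_ell2_def scaleR_ell2_def)
  show "c *\<^sub>C (x + y) = c *\<^sub>C x + c *\<^sub>C y"
    unfolding scaleC_ell2_def by transfer (simp add: algebra_simps)
  show "(c + d) *\<^sub>C x = c *\<^sub>C x + d *\<^sub>C x"
    unfolding scaleC_ell2_def by transfer (simp add: algebra_simps)
  show "c *\<^sub>C d *\<^sub>C x = (c * d) *\<^sub>C x"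
    unfolding scaleC_ell2_def by transfer (simp add: algebra_simps)
  show "cinner x y = cnj (cinner y x)"
    unfolding cinner_ell2_def by (rule ell2_cinner_commute)
  show "cinner (x + y) z = cinner x z + cinner y z"
    unfolding cinner_ell2_def by (rule ell2_cinner_add)
  show "cinner (c *\<^sub>C x) y = cnj c * cinner x y"
    unfolding cinner_ell2_def scaleC_ell2_def by (rule ell2_cinner_scale)
  show "x \<bullet> y = Re (cinner x y)"
    unfolding cinner_ell2_def by (rule inner_ell2_def)
next
  fix X :: "nat \<Rightarrow> ell2"
  assume "Cauchy X"
  have sq: "(\<lambda>n. (cmod (ell2_coord x n))\<^sup>2) sums (norm x)\<^sup>2" for x
    using ell2_square_sums[of x] by (simp add: power2_norm_eq_inner inner_ell2_def)
  have part: "(\<Sum>n<K. (cmod (ell2_coord x n))\<^sup>2) \<le> (norm x)\<^sup>2" for x K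
    using sum_le_suminf[OF sums_summable[OF sq[of x]], of "{..<K}"] sums_unique[OF sq[of x]] by simp
  have coord_le: "cmod (ell2_coord x n) \<le> norm x" for x n
  proof -
    have "(cmod (ell2_coord x n))\<^sup>2 \<le> (\<Sum>k<Suc n. (cmod (ell2_coord x k))\<^sup>2)"
      by (simp add: sum_nonneg)
    also have "\<dots> \<le> (norm x)\<^sup>2" by (rule part)
    finally show ?thesis by (rule power2_le_imp_le) simp
  qed
  have cau: "\<exists>M. \<forall>m\<ge>M. \<forall>k\<ge>M. norm (X m - X k) < e" if "0 < e" for e
    using \<open>Cauchy X\<close> that by (simp add: Cauchy_def dist_norm)
  have "\<exists>l. (\<lambda>m. ell2_coord (X m) n) \<longlonglongrightarrow> l" for n
  proof -
    have "Cauchy (\<lambda>m. ell2_coord (X m) n)"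
    proof (rule metric_CauchyI)
      fix e :: real assume "0 < e"
      then obtain M where M: "\<forall>m\<ge>M. \<forall>k\<ge>M. norm (X m - X k) < e" using cau by blast
      have "dist (ell2_coord (X m) n) (ell2_coord (X k) n) < e" if "m \<ge> M" "k \<ge> M" for m k
        using M that coord_le[of "X m - X k" n]
        by (auto simp: dist_norm minus_ell2.rep_eq intro: le_less_trans)
      then show "\<exists>M. \<forall>m\<ge>M. \<forall>k\<ge>M. dist (ell2_coord (X m) n) (ell2_coord (X k) n) < e" by blast
    qed
    then show ?thesis by (simp add: Cauchy_convergent_iff convergent_def)
  qed
  then obtain l where l: "\<And>n. (\<lambda>m. ell2_coord (X m) n) \<longlonglongrightarrow> l n" by metis
  have tail: "\<exists>M. \<forall>m\<ge>M. \<forall>K. (\<Sum>n<K. (cmod (ell2_coord (X m) n - l n))\<^sup>2) \<le> e\<^sup>2" if "0 < e" for e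
  proof -
    obtain M where M: "\<forall>m\<ge>M. \<forall>k\<ge>M. norm (X m - X k) < e" using cau[OF \<open>0 < e\<close>] by blast
    have "(\<Sum>n<K. (cmod (ell2_coord (X m) n - l n))\<^sup>2) \<le> e\<^sup>2" if "m \<ge> M" for m K
    proof (rule tendsto_upperbound)
      show "(\<lambda>k. \<Sum>n<K. (cmod (ell2_coord (X m) n - ell2_coord (X k) n))\<^sup>2)
          \<longlonglongrightarrow> (\<Sum>n<K. (cmod (ell2_coord (X m) n - l n))\<^sup>2)"
        by (intro tendsto_intros l)
      have "(\<Sum>n<K. (cmod (ell2_coord (X m) n - ell2_coord (X k) n))\<^sup>2) \<le> e\<^sup>2" if "k \<ge> M" for k
      proof -
        have "(\<Sum>n<K. (cmod (ell2_coord (X m) n - ell2_coord (X k) n))\<^sup>2) \<le> (norm (X m - X k))\<^sup>2"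
          using part[of "X m - X k" K] by (simp add: minus_ell2.rep_eq)
        also have "\<dots> \<le> e\<^sup>2"
          using M \<open>m \<ge> M\<close> \<open>k \<ge> M\<close> by (intro power_mono) (auto intro: less_imp_le)
        finally show ?thesis .
      qed
      then show "\<forall>\<^sub>F k in sequentially.
          (\<Sum>n<K. (cmod (ell2_coord (X m) n - ell2_coord (X k) n))\<^sup>2) \<le> e\<^sup>2"
        unfolding eventually_sequentially by blast
    qed simp
    then show ?thesis by blast
  qed
  have diff: "square_summable (\<lambda>n. ell2_coord (X m) n - l n)"
    if "\<forall>K. (\<Sum>n<K. (cmod (ell2_coord (X m) n - l n))\<^sup>2) \<le> e\<^sup>2" for m and e :: real
    unfolding square_summable_def using that by (intro summableI_nonneg_bounded) auto
  obtain M where "\<forall>K. (\<Sum>n<K. (cmod (ell2_coord (X M) n - l n))\<^sup>2) \<le> 1\<^sup>2"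
    using tail[of 1] by auto
  then have d: "square_summable (\<lambda>n. ell2_coord (X M) n - l n)" by (rule diff)
  have "square_summable (ell2_coord (X M))" using ell2_coord[of "X M"] by simp
  from square_summable_diff[OF this d]
  have lsq: "square_summable l" by simp
  define x where "x = Abs_ell2 l"
  have x: "ell2_coord x = l" using lsq by (simp add: x_def Abs_ell2_inverse)
  have "\<exists>M. \<forall>m\<ge>M. dist (X m) x < e" if "0 < e" for e
  proof -
    obtain M where M: "\<forall>m\<ge>M. \<forall>K. (\<Sum>n<K. (cmod (ell2_coord (X m) n - l n))\<^sup>2) \<le> (e/2)\<^sup>2"
      using tail[of "e/2"] \<open>0 < e\<close> by auto
    have "dist (X m) x < e" if "m \<ge> M" for m
    proof -
      have "(\<lambda>K. \<Sum>n<K. (cmod (ell2_coord (X m - x) n))\<^sup>2) \<longlonglongrightarrow> (norm (X m - x))\<^sup>2"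
        using sq[of "X m - x"] by (simp add: sums_def)
      then have "(norm (X m - x))\<^sup>2 \<le> (e/2)\<^sup>2"
      proof (rule tendsto_upperbound)
        have "(\<Sum>n<K. (cmod (ell2_coord (X m - x) n))\<^sup>2) \<le> (e/2)\<^sup>2" for K
          using M \<open>m \<ge> M\<close> unfolding minus_ell2.rep_eq x by blast
        then show "\<forall>\<^sub>F K in sequentially. (\<Sum>n<K. (cmod (ell2_coord (X m - x) n))\<^sup>2) \<le> (e/2)\<^sup>2"
          by (intro always_eventually allI)
      qed simp
      then have "norm (X m - x) \<le> e/2"
        by (rule power2_le_imp_le) (use \<open>0 < e\<close> in simp)
      then show ?thesis using \<open>0 < e\<close> by (simp add: dist_norm)
    qed
    then show ?thesis by blast
  qed
  then have "X \<longlonglongrightarrow> x"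
    unfolding lim_sequentially by blast
  then show "convergent X" by (auto simp: convergent_def)
qed

end


section \<open>Operators\<close>

text \<open>Operators are elements of the library type of bounded (a priori only real-linear) maps.
Complex linearity is not lost: it follows from self-adjointness for the complex inner product
(lemma \<open>selfadjoint_scaleC\<close>), and the inverse of a complex-linear bijection is complex-linear, so
invertibility and spectrum of such operators mean the same as in the algebra of complex-linear
operators.\<close>

definition selfadjoint :: "('a::chilbert_space \<Rightarrow>\<^sub>L 'a) \<Rightarrow> bool" where
  "selfadjoint A \<longleftrightarrow> (\<forall>x y. cinner (A x) y = cinner x (A y))"

lemma selfadjoint_scaleC: "selfadjoint A \<Longrightarrow> A (c *\<^sub>C x) = c *\<^sub>C A x"
  by (rule cinner_ext) (metis selfadjoint_def cinner_scaleC_right)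

definition positive_op :: "('a::chilbert_space \<Rightarrow>\<^sub>L 'a) \<Rightarrow> bool" where
  "positive_op A \<longleftrightarrow> selfadjoint A \<and> (\<forall>x. 0 \<le> Re (cinner x (A x)))"

definition op_le :: "('a::chilbert_space \<Rightarrow>\<^sub>L 'a) \<Rightarrow> ('a \<Rightarrow>\<^sub>L 'a) \<Rightarrow> bool" (infix "\<preceq>" 50) where
  "X \<preceq> Y \<longleftrightarrow> positive_op (Y - X)"

definition invertible_op :: "('a::chilbert_space \<Rightarrow>\<^sub>L 'a) \<Rightarrow> bool" where
  "invertible_op A \<longleftrightarrow> (\<exists>B. A o\<^sub>L B = id_blinfun \<and> B o\<^sub>L A = id_blinfun)"

definition strictly_positive :: "('a::chilbert_space \<Rightarrow>\<^sub>L 'a) \<Rightarrow> bool" where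
  "strictly_positive A \<longleftrightarrow> positive_op A \<and> invertible_op A"

definition scalar_op :: "complex \<Rightarrow> 'a::chilbert_space \<Rightarrow>\<^sub>L 'a" where
  "scalar_op c = Blinfun (\<lambda>x. c *\<^sub>C x)"

lemma scalar_op_apply [simp]: "scalar_op c x = c *\<^sub>C x"
  by (simp add: scalar_op_def bounded_linear_Blinfun_apply bounded_linear_scaleC)

definition spectrum :: "('a::chilbert_space \<Rightarrow>\<^sub>L 'a) \<Rightarrow> complex set" where
  "spectrum A = {c. \<not> invertible_op (A - scalar_op c)}"

abbreviation spectrum_in :: "('a::chilbert_space \<Rightarrow>\<^sub>L 'a) \<Rightarrow> real set \<Rightarrow> bool" where
  "spectrum_in A J \<equiv> spectrum A \<subseteq> complex_of_real ` J"


section \<open>Continuous functional calculus\<close>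

definition poly_op :: "real poly \<Rightarrow> ('a::chilbert_space \<Rightarrow>\<^sub>L 'a) \<Rightarrow> ('a \<Rightarrow>\<^sub>L 'a)" where
  "poly_op p A = (\<Sum>k\<le>degree p. coeff p k *\<^sub>R (((o\<^sub>L) A ^^ k) id_blinfun))"

text \<open>For a self-adjoint \<open>A\<close> and a function \<open>f\<close> that is continuous on the spectrum, \<open>f(A)\<close> is the
common norm limit of \<open>p\<^sub>n(A)\<close> for all sequences of polynomials \<open>p\<^sub>n\<close> tending to \<open>f\<close> uniformly on the
spectrum of \<open>A\<close>. Only used for such \<open>A\<close> and \<open>f\<close>.\<close>

definition fun_calc :: "(real \<Rightarrow> real) \<Rightarrow> ('a::chilbert_space \<Rightarrow>\<^sub>L 'a) \<Rightarrow> ('a \<Rightarrow>\<^sub>L 'a)" where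
  "fun_calc f A = (THE B. \<forall>p :: nat \<Rightarrow> real poly.
     uniform_limit {t. complex_of_real t \<in> spectrum A} (\<lambda>n. poly (p n)) f sequentially \<longrightarrow>
     (\<lambda>n. poly_op (p n) A) \<longlonglongrightarrow> B)"

definition powr_op :: "('a::chilbert_space \<Rightarrow>\<^sub>L 'a) \<Rightarrow> real \<Rightarrow> ('a \<Rightarrow>\<^sub>L 'a)" where
  "powr_op R a = fun_calc (\<lambda>t. t powr a) R"


section \<open>Operator convexity, perspective and f-divergence functional\<close>

definition operator_convex_in ::
  "'h::chilbert_space itself \<Rightarrow> real set \<Rightarrow> (real \<Rightarrow> real) \<Rightarrow> bool" where
  "operator_convex_in TYPE('h) J f \<longleftrightarrow>
     (\<forall>(X :: 'h \<Rightarrow>\<^sub>L 'h) Y. \<forall>t\<in>{0..1}.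
        selfadjoint X \<and> selfadjoint Y \<and> spectrum_in X J \<and> spectrum_in Y J \<longrightarrow>
        fun_calc f (t *\<^sub>R X + (1 - t) *\<^sub>R Y) \<preceq> t *\<^sub>R fun_calc f X + (1 - t) *\<^sub>R fun_calc f Y)"

text \<open>Operator convexity is a property of \<open>f\<close> alone, referring to operators on arbitrary Hilbert
spaces. HOL cannot quantify over types inside a formula, so the inequality is demanded on the
infinite-dimensional separable space \<open>ell2\<close>. On a space of small finite dimension alone it would
be a weaker condition (on dimension one, mere convexity). Since any two bounded operators leave
invariant, together with their adjoints, the separable closed subspace generated by a vector, the
inequality on \<open>ell2\<close> implies that on every Hilbert space.\<close>

definition operator_convex :: "real set \<Rightarrow> (real \<Rightarrow> real) \<Rightarrow> bool" where
  "operator_convex J f \<longleftrightarrow>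
     is_interval J \<and> continuous_on J f \<and> operator_convex_in TYPE(ell2) J f"

definition perspective ::
  "(real \<Rightarrow> real) \<Rightarrow> ('a::chilbert_space \<Rightarrow>\<^sub>L 'a) \<Rightarrow> ('a \<Rightarrow>\<^sub>L 'a) \<Rightarrow> ('a \<Rightarrow>\<^sub>L 'a)" where
  "perspective f L R =
     powr_op R (1/2) o\<^sub>L fun_calc f (powr_op R (-1/2) o\<^sub>L L o\<^sub>L powr_op R (-1/2)) o\<^sub>L powr_op R (1/2)"

text \<open>Tuples of length \<open>n\<close> are functions evaluated on \<open>{1..n}\<close>.\<close>

definition f_divergence :: "(real \<Rightarrow> real) \<Rightarrow> nat \<Rightarrow>
    (nat \<Rightarrow> 'a::chilbert_space \<Rightarrow>\<^sub>L 'a) \<Rightarrow> (nat \<Rightarrow> 'a \<Rightarrow>\<^sub>L 'a) \<Rightarrow> ('a \<Rightarrow>\<^sub>L 'a)" where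
  "f_divergence f n Ls Rs = (\<Sum>i\<in>{1..n}.
     powr_op (Rs i) (1/2)
       o\<^sub>L fun_calc f (powr_op (Rs i) (-1/2) o\<^sub>L Ls i o\<^sub>L powr_op (Rs i) (-1/2))
       o\<^sub>L powr_op (Rs i) (1/2))"

end

theory Submission
  imports Defs "HOL-Computational_Algebra.Fundamental_Theorem_Algebra"
begin

text \<open>The functional \<open>\<Theta>\<close> is a sum of perspectives, so after exchanging the two sums the theorem says, for
each \<open>i\<close> separately, that \<open>g (\<Sum>\<^sub>j p\<^sub>j L\<^sub>i\<^sub>j, \<Sum>\<^sub>j p\<^sub>j R\<^sub>i\<^sub>j) \<le> \<Sum>\<^sub>j p\<^sub>j g (L\<^sub>i\<^sub>j, R\<^sub>i\<^sub>j)\<close>: the perspective is jointly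
convex and homogeneous (\<open>perspective_jointly_convex\<close>, \<open>perspective_sum_le\<close>). Both properties are
instances of Jensen's operator inequality \<open>f (A' X A + B' Y B) \<le> A' f(X) A + B' f(Y) B\<close> for
\<open>A' A + B' B = 1\<close> (\<open>jensen_pair\<close>), where \<open>A'\<close> and \<open>B'\<close> are the adjoints: for \<open>R = p R\<^sub>0 + q R\<^sub>1\<close> take
\<open>A = \<surd>p R\<^sub>0\<^sup>1\<^sup>/\<^sup>2 R\<^sup>-\<^sup>1\<^sup>/\<^sup>2\<close> and \<open>B = \<surd>q R\<^sub>1\<^sup>1\<^sup>/\<^sup>2 R\<^sup>-\<^sup>1\<^sup>/\<^sup>2\<close>.

Jensen's inequality for a single isometry \<open>C\<close>, that is \<open>f (C' Z C) \<le> C' f(Z) C\<close>, is operator convexity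
at the midpoint of \<open>Z\<close> and \<open>V Z V\<close>, where \<open>V\<close> is the reflection at the range of \<open>C\<close>
(\<open>jensen_isometry\<close>). The two-term version is the one for \<open>x \<mapsto> (A x, B x)\<close>, an isometry from the given
space \<open>H\<close> to \<open>H \<times> H\<close>. So operator convexity is needed on \<open>H \<times> H\<close>, while it is given on \<open>ell2\<close>. It
passes from \<open>ell2\<close> to every Hilbert space (\<open>operator_convex_on_every_space\<close>) because the inequality
may be tested on one vector \<open>x\<close> at a time and with \<open>f\<close> replaced by a polynomial \<open>q\<close>. The value of
\<open>q\<close> of an operator at \<open>x\<close> involves only finitely many vectors, whose span embeds isometrically into
\<open>ell2\<close>; compressing the operators to this span changes nothing at \<open>x\<close> (\<open>fun_calc_compression\<close>).

All of this rests on the continuous functional calculus: for self-adjoint \<open>A\<close>, \<open>norm (q(A))\<close> is at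
most the supremum of \<open>|q|\<close> on the spectrum of \<open>A\<close> (\<open>norm_poly_op_le\<close>), so \<open>f(A)\<close> exists
(\<open>fun_calc_limit\<close>), is multiplicative in \<open>f\<close>, and inherits intertwining relations \<open>A V = V B\<close>
(\<open>fun_calc_intertwine\<close>). The norm bound comes from factoring real polynomials into linear and
quadratic factors, and from the invertibility of coercive operators (Lax--Milgram).\<close>

section \<open>Adjoint pairs and self-adjoint operators\<close>

lemma cinner_scaleR_left: "cinner (r *\<^sub>R x) y = of_real r * cinner x y"
  for x y :: "'a::chilbert_space"
  by (simp add: cinner_scaleC_left flip: scaleC_of_real)

lemma cinner_scaleR_right: "cinner x (r *\<^sub>R y) = of_real r * cinner x y"
  for x y :: "'a::chilbert_space"
  by (simp add: cinner_scaleC_right flip: scaleC_of_real)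

lemma cinner_zero_left [simp]: "cinner 0 y = 0" for y :: "'a::chilbert_space"
  using cinner_scaleR_left[of 0 0 y] by simp

lemma cinner_zero_right [simp]: "cinner x 0 = 0" for x :: "'a::chilbert_space"
  using cinner_scaleR_right[of x 0 0] by simp

lemma cinner_diff_left: "cinner (x - y) z = cinner x z - cinner y z"
  for x y z :: "'a::chilbert_space"
  using cinner_add_left[of "x - y" y z] by simp

lemma cinner_diff_right: "cinner z (x - y) = cinner z x - cinner z y"
  for x y z :: "'a::chilbert_space"
  using cinner_add_right[of z "x - y" y] by simp

lemma cinner_sum_right: "cinner y (sum f S) = (\<Sum>i\<in>S. cinner y (f i))"
  for y :: "'a::chilbert_space"
  by (induction S rule: infinite_finite_induct) (auto simp: cinner_add_right)

text \<open>The imaginary part of the complex inner product is itself a real inner product, after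
multiplying one vector by the imaginary unit. Continuity questions thereby reduce to the real case.\<close>

lemma cinner_conv_inner: "cinner x y = Complex (x \<bullet> y) ((\<i> *\<^sub>C x) \<bullet> y)"
  for x y :: "'a::chilbert_space"
  by (rule complex_eqI) (simp_all add: inner_eq_Re_cinner cinner_scaleC_left)

lemma tendsto_cinner:
  fixes x y :: "'b \<Rightarrow> 'a::chilbert_space"
  assumes "(x \<longlongrightarrow> a) F" "(y \<longlongrightarrow> b) F"
  shows "((\<lambda>n. cinner (x n) (y n)) \<longlongrightarrow> cinner a b) F"
  unfolding cinner_conv_inner
  by (intro tendsto_Complex tendsto_inner assms bounded_linear.tendsto[OF bounded_linear_scaleC])

definition adjoint_pair ::
  "('a::chilbert_space \<Rightarrow>\<^sub>L 'b::chilbert_space) \<Rightarrow> ('b \<Rightarrow>\<^sub>L 'a) \<Rightarrow> bool" where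
  "adjoint_pair A A' \<longleftrightarrow> (\<forall>x y. cinner (A x) y = cinner x (A' y))"

lemma selfadjoint_iff_adjoint_pair: "selfadjoint A \<longleftrightarrow> adjoint_pair A A"
  by (simp add: selfadjoint_def adjoint_pair_def)

lemma adjoint_pair_sym: "adjoint_pair A A' \<Longrightarrow> adjoint_pair A' A"
  unfolding adjoint_pair_def by (metis cinner_commute)

lemma adjoint_pair_inner: "adjoint_pair A A' \<Longrightarrow> A x \<bullet> y = x \<bullet> A' y"
  by (simp add: adjoint_pair_def inner_eq_Re_cinner)

lemma selfadjoint_inner: "selfadjoint A \<Longrightarrow> A x \<bullet> y = x \<bullet> A y"
  by (simp add: selfadjoint_def inner_eq_Re_cinner)

lemma adjoint_pair_add:
  "adjoint_pair A A' \<Longrightarrow> adjoint_pair B B' \<Longrightarrow> adjoint_pair (A + B) (A' + B')"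
  by (simp add: adjoint_pair_def blinfun.add_left cinner_add_left cinner_add_right)

lemma adjoint_pair_diff:
  "adjoint_pair A A' \<Longrightarrow> adjoint_pair B B' \<Longrightarrow> adjoint_pair (A - B) (A' - B')"
  by (simp add: adjoint_pair_def blinfun.diff_left cinner_diff_left cinner_diff_right)

lemma adjoint_pair_scaleR: "adjoint_pair A A' \<Longrightarrow> adjoint_pair (r *\<^sub>R A) (r *\<^sub>R A')"
  by (simp add: adjoint_pair_def blinfun.scaleR_left cinner_scaleR_left cinner_scaleR_right)

lemma adjoint_pair_compose:
  "adjoint_pair A A' \<Longrightarrow> adjoint_pair B B' \<Longrightarrow> adjoint_pair (A o\<^sub>L B) (B' o\<^sub>L A')"
  by (simp add: adjoint_pair_def)

lemma adjoint_pair_zero: "adjoint_pair 0 0"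
  by (simp add: adjoint_pair_def)

lemma adjoint_pair_sum:
  "(\<And>i. i \<in> S \<Longrightarrow> adjoint_pair (A i) (A' i)) \<Longrightarrow> adjoint_pair (\<Sum>i\<in>S. A i) (\<Sum>i\<in>S. A' i)"
  by (induction S rule: infinite_finite_induct) (auto intro: adjoint_pair_add adjoint_pair_zero)

lemma adjoint_pair_id: "adjoint_pair id_blinfun id_blinfun"
  by (simp add: adjoint_pair_def)

lemmas adjoint_pair_intros = adjoint_pair_add adjoint_pair_diff adjoint_pair_scaleR
  adjoint_pair_compose adjoint_pair_zero adjoint_pair_sum adjoint_pair_id

lemma selfadjoint_add: "selfadjoint A \<Longrightarrow> selfadjoint B \<Longrightarrow> selfadjoint (A + B)"
  and selfadjoint_diff: "selfadjoint A \<Longrightarrow> selfadjoint B \<Longrightarrow> selfadjoint (A - B)"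
  and selfadjoint_scaleR: "selfadjoint A \<Longrightarrow> selfadjoint (r *\<^sub>R A)"
  and selfadjoint_id: "selfadjoint id_blinfun"
  and selfadjoint_zero: "selfadjoint 0"
  by (auto simp: selfadjoint_iff_adjoint_pair intro: adjoint_pair_intros)

lemma selfadjoint_conj:
  "adjoint_pair W W' \<Longrightarrow> selfadjoint A \<Longrightarrow> selfadjoint (W' o\<^sub>L A o\<^sub>L W)"
  by (simp add: adjoint_pair_def selfadjoint_def) (metis cinner_commute)

lemma selfadjoint_limit:
  assumes "\<And>n. selfadjoint (X n)" and lim: "X \<longlonglongrightarrow> A"
  shows "selfadjoint A"
  unfolding selfadjoint_def
proof (intro allI)
  fix x y
  have "(\<lambda>n. cinner (X n x) y) \<longlonglongrightarrow> cinner (A x) y"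
    by (intro tendsto_cinner tendsto_intros lim)
  moreover have "(\<lambda>n. cinner (X n x) y) \<longlonglongrightarrow> cinner x (A y)"
    unfolding assms(1)[unfolded selfadjoint_def, rule_format]
    by (intro tendsto_cinner tendsto_intros lim)
  ultimately show "cinner (A x) y = cinner x (A y)"
    by (rule LIMSEQ_unique)
qed

lemma positive_op_iff: "positive_op A \<longleftrightarrow> selfadjoint A \<and> (\<forall>x. 0 \<le> x \<bullet> A x)"
  by (simp add: positive_op_def inner_eq_Re_cinner)

lemma op_leI:
  assumes "selfadjoint X" "selfadjoint Y" "\<And>x. x \<bullet> X x \<le> x \<bullet> Y x"
  shows "X \<preceq> Y"
  using assms by (simp add: op_le_def positive_op_iff selfadjoint_diff blinfun.diff_left inner_diff_right)

lemma op_leD: "X \<preceq> Y \<Longrightarrow> x \<bullet> X x \<le> x \<bullet> Y x"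
  by (simp add: op_le_def positive_op_iff blinfun.diff_left inner_diff_right)

section \<open>Invertibility of coercive operators\<close>

text \<open>Lax--Milgram: for small positive \<open>s\<close> the map \<open>x \<mapsto> x - s (T x - y)\<close> is a contraction, and its
fixed point solves \<open>T x = y\<close>.\<close>

lemma coercive_solvable:
  fixes T :: "'a::chilbert_space \<Rightarrow>\<^sub>L 'a"
  assumes m: "0 < m" and coercive: "\<And>x. m * (norm x)\<^sup>2 \<le> x \<bullet> T x"
  shows "\<exists>!x. T x = y"
proof -
  \<comment> \<open>The squared contraction factor is \<open>1 - 2 s m + s\<^sup>2 M\<^sup>2\<close>, which is least at \<open>s = m / M\<^sup>2\<close>; it is
    nonnegative there because \<open>m \<le> M\<close>.\<close>
  define M where "M = max m (norm T)"
  define s where "s = m / M\<^sup>2"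
  define q where "q = 1 - m\<^sup>2 / M\<^sup>2"
  have M: "0 < M" "m \<le> M" "norm T \<le> M"
    using m by (auto simp: M_def)
  have s: "0 < s" using m M by (simp add: s_def)
  have q: "0 \<le> q" "q < 1"
    using m M by (auto simp: q_def power_mono)
  have contract: "norm (x - s *\<^sub>R T x) \<le> sqrt q * norm x" for x
  proof -
    have "norm (T x) \<le> M * norm x"
      using norm_blinfun[of T x] M by (meson mult_right_mono norm_ge_zero order_trans)
    then have T: "(norm (T x))\<^sup>2 \<le> M\<^sup>2 * (norm x)\<^sup>2"
      by (metis norm_ge_zero power_mono power_mult_distrib)
    have "(norm (x - s *\<^sub>R T x))\<^sup>2 = (norm x)\<^sup>2 - 2 * s * (x \<bullet> T x) + s\<^sup>2 * (norm (T x))\<^sup>2"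
      unfolding power2_norm_eq_inner
      by (simp add: inner_diff_left inner_diff_right inner_commute power2_eq_square algebra_simps)
    also have "\<dots> \<le> (norm x)\<^sup>2 - 2 * s * (m * (norm x)\<^sup>2) + s\<^sup>2 * (M\<^sup>2 * (norm x)\<^sup>2)"
      using s T coercive[of x] by (intro add_mono diff_mono mult_left_mono) auto
    also have "\<dots> = q * (norm x)\<^sup>2"
      using M by (simp add: s_def q_def field_simps power2_eq_square)
    finally have "(norm (x - s *\<^sub>R T x))\<^sup>2 \<le> (sqrt q * norm x)\<^sup>2"
      using q by (simp add: power_mult_distrib)
    then show ?thesis
      by (rule power2_le_imp_le) (use q in simp)
  qed
  have "\<exists>!x. x - s *\<^sub>R (T x - y) = x"
  proof (rule banach_fix_type)
    show "0 \<le> sqrt q" "sqrt q < 1" using q by auto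
    show "\<forall>u v. dist (u - s *\<^sub>R (T u - y)) (v - s *\<^sub>R (T v - y)) \<le> sqrt q * dist u v"
    proof (intro allI)
      fix u v
      have "u - s *\<^sub>R (T u - y) - (v - s *\<^sub>R (T v - y)) = (u - v) - s *\<^sub>R T (u - v)"
        by (simp add: blinfun.diff_right scaleR_diff_right)
      then show "dist (u - s *\<^sub>R (T u - y)) (v - s *\<^sub>R (T v - y)) \<le> sqrt q * dist u v"
        using contract[of "u - v"] by (simp only: dist_norm)
    qed
  qed
  then show ?thesis using s by simp
qed

lemma invertible_opI_bij:
  fixes T :: "'a::chilbert_space \<Rightarrow>\<^sub>L 'a"
  assumes m: "0 < m" and below: "\<And>x. m * norm x \<le> norm (T x)" and sol: "\<And>y. \<exists>x. T x = y"
  shows "invertible_op T"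
proof -
  obtain g where g: "\<And>y. T (g y) = y" using sol by metis
  have inj: "u = v" if "T u = T v" for u v
    using below[of "u - v"] that m by (simp add: blinfun.diff_right mult_le_0_iff)
  have lin: "bounded_linear g"
  proof (rule bounded_linear_intro[where K = "inverse m"])
    show "g (x + y) = g x + g y" for x y
      by (rule inj) (simp add: g blinfun.add_right)
    show "g (r *\<^sub>R x) = r *\<^sub>R g x" for r x
      by (rule inj) (simp add: g blinfun.scaleR_right)
    show "norm (g x) \<le> norm x * inverse m" for x
      using below[of "g x"] m by (simp add: g field_simps)
  qed
  have "T o\<^sub>L Blinfun g = id_blinfun"
    by (rule blinfun_eqI) (simp add: bounded_linear_Blinfun_apply[OF lin] g)
  moreover have "Blinfun g o\<^sub>L T = id_blinfun"
    by (rule blinfun_eqI) (simp add: bounded_linear_Blinfun_apply[OF lin] inj g)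
  ultimately show ?thesis
    unfolding invertible_op_def by blast
qed

lemma coercive_imp_bounded_below:
  fixes T :: "'a::chilbert_space \<Rightarrow>\<^sub>L 'a"
  assumes "m * (norm x)\<^sup>2 \<le> x \<bullet> T x"
  shows "m * norm x \<le> norm (T x)"
proof (cases "x = 0")
  case False
  have "(m * norm x) * norm x \<le> norm (T x) * norm x"
    using assms norm_cauchy_schwarz[of x "T x"] by (simp add: power2_eq_square mult.commute mult.left_commute)
  then show ?thesis using False by (simp add: mult_le_cancel_right)
qed simp

lemma coercive_imp_invertible:
  fixes T :: "'a::chilbert_space \<Rightarrow>\<^sub>L 'a"
  assumes "0 < m" "\<And>x. m * (norm x)\<^sup>2 \<le> x \<bullet> T x"
  shows "invertible_op T"
  using assms coercive_solvable[OF assms]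
  by (intro invertible_opI_bij[OF assms(1)] coercive_imp_bounded_below) blast+

lemma blinfun_compose_assoc: "(A o\<^sub>L B) o\<^sub>L C = A o\<^sub>L (B o\<^sub>L C)"
  by (rule blinfun_eqI) simp

lemma blinfun_compose_id [simp]: "A o\<^sub>L id_blinfun = A" "id_blinfun o\<^sub>L A = A"
  by (rule blinfun_eqI, simp)+

lemma invertible_op_compose:
  assumes "invertible_op A" "invertible_op B"
  shows "invertible_op (A o\<^sub>L B)"
proof -
  obtain A' where A': "A o\<^sub>L A' = id_blinfun" "A' o\<^sub>L A = id_blinfun"
    using assms unfolding invertible_op_def by blast
  obtain B' where B': "B o\<^sub>L B' = id_blinfun" "B' o\<^sub>L B = id_blinfun"
    using assms unfolding invertible_op_def by blast
  have "(A o\<^sub>L B) o\<^sub>L (B' o\<^sub>L A') = A o\<^sub>L (B o\<^sub>L B') o\<^sub>L A'"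
    "(B' o\<^sub>L A') o\<^sub>L (A o\<^sub>L B) = B' o\<^sub>L (A' o\<^sub>L A) o\<^sub>L B"
    by (simp_all only: blinfun_compose_assoc)
  then show ?thesis unfolding invertible_op_def using A' B'
    by (intro exI[of _ "B' o\<^sub>L A'"]) simp
qed

text \<open>A factor of an invertible product of commuting operators has a left and a right inverse, which
must coincide.\<close>

lemma invertible_op_factor:
  assumes comm: "A o\<^sub>L B = B o\<^sub>L A" and inv: "invertible_op (A o\<^sub>L B)"
  shows "invertible_op A"
proof -
  obtain C where C: "(A o\<^sub>L B) o\<^sub>L C = id_blinfun" "C o\<^sub>L (A o\<^sub>L B) = id_blinfun"
    using inv unfolding invertible_op_def by blast
  have r: "A o\<^sub>L (B o\<^sub>L C) = id_blinfun" using C by (simp add: blinfun_compose_assoc)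
  have l: "(C o\<^sub>L B) o\<^sub>L A = id_blinfun" using C by (simp add: comm blinfun_compose_assoc)
  have "C o\<^sub>L B = (C o\<^sub>L B) o\<^sub>L (A o\<^sub>L (B o\<^sub>L C))" by (simp add: r)
  also have "\<dots> = ((C o\<^sub>L B) o\<^sub>L A) o\<^sub>L (B o\<^sub>L C)" by (simp only: blinfun_compose_assoc)
  finally have "C o\<^sub>L B = B o\<^sub>L C" by (simp add: l)
  then show ?thesis unfolding invertible_op_def using r l by metis
qed

lemma invertible_op_uminus: "invertible_op A \<Longrightarrow> invertible_op (- A)"
  unfolding invertible_op_def
proof (elim exE conjE)
  fix B assume B: "A o\<^sub>L B = id_blinfun" "B o\<^sub>L A = id_blinfun"
  have "(- A) o\<^sub>L (- B) = A o\<^sub>L B" "(- B) o\<^sub>L (- A) = B o\<^sub>L A"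
    by (rule blinfun_eqI, simp add: blinfun.minus_left blinfun.minus_right)+
  then show "\<exists>B. (- A) o\<^sub>L B = id_blinfun \<and> B o\<^sub>L (- A) = id_blinfun" using B by metis
qed

lemma invertible_op_bounded_below:
  assumes "invertible_op A"
  obtains m where "0 < m" "\<And>x. m * norm x \<le> norm (A x)"
proof -
  obtain B where B: "B o\<^sub>L A = id_blinfun" using assms unfolding invertible_op_def by blast
  have "inverse (norm B + 1) * norm x \<le> norm (A x)" for x
  proof -
    have "norm x = norm (B (A x))"
      using B by (metis blinfun_apply_blinfun_compose blinfun_apply_id_blinfun)
    also have "\<dots> \<le> (norm B + 1) * norm (A x)"
      using norm_blinfun[of B "A x"] by (simp add: algebra_simps) (smt (verit) norm_ge_zero)
    finally show ?thesis by (simp add: field_simps add_pos_nonneg)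
  qed
  moreover have "0 < inverse (norm B + 1)" by (simp add: add_nonneg_pos)
  ultimately show ?thesis using that by blast
qed

section \<open>The spectrum of a self-adjoint operator\<close>

lemma scalar_op_of_real: "scalar_op (complex_of_real t) = t *\<^sub>R id_blinfun"
  by (rule blinfun_eqI) (simp add: blinfun.scaleR_left scaleC_of_real)

text \<open>The operator is \<open>(A - a)\<^sup>2 + b\<^sup>2\<close>, so its quadratic form at \<open>x\<close> is at least \<open>b\<^sup>2 (x \<bullet> x)\<close>.\<close>

lemma selfadjoint_quadratic_invertible:
  fixes A :: "'a::chilbert_space \<Rightarrow>\<^sub>L 'a"
  assumes A: "selfadjoint A" and b: "b \<noteq> 0"
  shows "invertible_op ((A o\<^sub>L A) - (2 * a) *\<^sub>R A + (a\<^sup>2 + b\<^sup>2) *\<^sub>R id_blinfun)"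
proof (rule coercive_imp_invertible)
  show "0 < b\<^sup>2" using b by simp
  fix x :: 'a
  have "x \<bullet> ((A o\<^sub>L A) - (2 * a) *\<^sub>R A + (a\<^sup>2 + b\<^sup>2) *\<^sub>R id_blinfun) x
      = (A x - a *\<^sub>R x) \<bullet> (A x - a *\<^sub>R x) + b\<^sup>2 * (x \<bullet> x)"
    by (simp add: blinfun.bilinear_simps inner_diff_left inner_diff_right inner_add_right inner_commute
        selfadjoint_inner[OF A, of x "A x", symmetric] power2_eq_square algebra_simps)
  then show "b\<^sup>2 * (norm x)\<^sup>2 \<le> x \<bullet> ((A o\<^sub>L A) - (2 * a) *\<^sub>R A + (a\<^sup>2 + b\<^sup>2) *\<^sub>R id_blinfun) x"
    by (simp add: power2_norm_eq_inner)
qed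

text \<open>For \<open>c = a + \<i> b\<close> the commuting operators \<open>A - c\<close> and \<open>A - cnj c\<close> have the product
\<open>(A - a)\<^sup>2 + b\<^sup>2\<close>, which is invertible if \<open>b \<noteq> 0\<close>.\<close>

lemma selfadjoint_spectrum_real:
  assumes A: "selfadjoint A" and c: "c \<in> spectrum A"
  shows "c = complex_of_real (Re c)"
proof (rule ccontr)
  assume "c \<noteq> complex_of_real (Re c)"
  then have im: "Im c \<noteq> 0" by (auto simp: complex_eq_iff)
  have "cnj c * c = complex_of_real ((Re c)\<^sup>2 + (Im c)\<^sup>2)"
    "c + cnj c = complex_of_real (2 * Re c)"
    by (auto simp: complex_eq_iff power2_eq_square)
  then have cc: "cnj c *\<^sub>C c *\<^sub>C x = ((Re c)\<^sup>2 + (Im c)\<^sup>2) *\<^sub>R x"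
    "c *\<^sub>C cnj c *\<^sub>C x = ((Re c)\<^sup>2 + (Im c)\<^sup>2) *\<^sub>R x"
    "c *\<^sub>C x + cnj c *\<^sub>C x = (2 * Re c) *\<^sub>R x" for x :: 'a
    by (simp_all only: scaleC_scaleC scaleC_of_real mult.commute flip: scaleC_add_left)
  have mul: "(A - scalar_op d) o\<^sub>L (A - scalar_op e)
      = (A o\<^sub>L A) - (2 * Re c) *\<^sub>R A + ((Re c)\<^sup>2 + (Im c)\<^sup>2) *\<^sub>R id_blinfun"
    if "(d, e) \<in> {(c, cnj c), (cnj c, c)}" for d e
  proof (rule blinfun_eqI)
    fix x
    have sc: "d *\<^sub>C (y - z) = d *\<^sub>C y - d *\<^sub>C z" for y z :: 'a
      using bounded_linear_scaleC[of d] by (rule linear_diff[OF bounded_linear.linear])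
    have "A (A x) - d *\<^sub>C A x - (e *\<^sub>C A x - d *\<^sub>C e *\<^sub>C x)
        = A (A x) - (c *\<^sub>C A x + cnj c *\<^sub>C A x) + ((Re c)\<^sup>2 + (Im c)\<^sup>2) *\<^sub>R x"
      using that cc(1,2)[of x] by (auto simp: algebra_simps)
    then show "((A - scalar_op d) o\<^sub>L (A - scalar_op e)) x
        = ((A o\<^sub>L A) - (2 * Re c) *\<^sub>R A + ((Re c)\<^sup>2 + (Im c)\<^sup>2) *\<^sub>R id_blinfun) x"
      by (simp add: blinfun.bilinear_simps selfadjoint_scaleC[OF A] sc cc(3))
  qed
  have "invertible_op (A - scalar_op c)"
    by (rule invertible_op_factor[of _ "A - scalar_op (cnj c)"])
      (simp_all add: mul selfadjoint_quadratic_invertible[OF A im])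
  with c show False by (simp add: spectrum_def)
qed

lemma spectrum_in_quadratic_form_bounds:
  fixes A :: "'a::chilbert_space \<Rightarrow>\<^sub>L 'a"
  assumes A: "selfadjoint A"
    and low: "\<And>x. m * (norm x)\<^sup>2 \<le> x \<bullet> A x" and up: "\<And>x. x \<bullet> A x \<le> M * (norm x)\<^sup>2"
  shows "spectrum_in A {m..M}"
proof
  fix c assume c: "c \<in> spectrum A"
  define t where "t = Re c"
  have ct: "c = complex_of_real t"
    using selfadjoint_spectrum_real[OF A c] by (simp add: t_def)
  have ninv: "\<not> invertible_op (A - t *\<^sub>R id_blinfun)"
    using c by (simp add: ct spectrum_def scalar_op_of_real)
  have "m \<le> t"
  proof (rule ccontr)
    assume "\<not> m \<le> t"
    moreover have "(m - t) * (norm x)\<^sup>2 \<le> x \<bullet> (A - t *\<^sub>R id_blinfun) x" for x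
      using low[of x] by (simp add: blinfun.bilinear_simps inner_diff_right power2_norm_eq_inner algebra_simps)
    ultimately show False using ninv coercive_imp_invertible[of "m - t"] by auto
  qed
  moreover have "t \<le> M"
  proof (rule ccontr)
    assume "\<not> t \<le> M"
    moreover have "(t - M) * (norm x)\<^sup>2 \<le> x \<bullet> (- (A - t *\<^sub>R id_blinfun)) x" for x
      using up[of x] by (simp add: blinfun.bilinear_simps inner_diff_right power2_norm_eq_inner algebra_simps)
    ultimately have "invertible_op (- (A - t *\<^sub>R id_blinfun))"
      using coercive_imp_invertible[of "t - M"] by auto
    from invertible_op_uminus[OF this] show False using ninv by simp
  qed
  ultimately show "c \<in> complex_of_real ` {m..M}" by (auto simp: ct)
qed

lemma quadratic_form_le_norm: "\<bar>x \<bullet> A x\<bar> \<le> norm A * (norm x)\<^sup>2"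
  for A :: "'a::chilbert_space \<Rightarrow>\<^sub>L 'a"
proof -
  have "\<bar>x \<bullet> A x\<bar> \<le> norm x * norm (A x)" by (rule Cauchy_Schwarz_ineq2)
  also have "\<dots> \<le> norm x * (norm A * norm x)" by (intro mult_left_mono norm_blinfun) simp
  finally show ?thesis by (simp add: power2_eq_square mult_ac)
qed

lemma positive_op_spectrum:
  assumes "positive_op A" "norm A \<le> M"
  shows "spectrum_in A {0..M}"
proof (rule spectrum_in_quadratic_form_bounds)
  show "x \<bullet> A x \<le> M * (norm x)\<^sup>2" for x
    using quadratic_form_le_norm[of x A] mult_right_mono[OF assms(2), of "(norm x)\<^sup>2"] by simp
qed (use assms(1) in \<open>auto simp: positive_op_iff\<close>)

section \<open>Polynomials of an operator\<close>

lemma poly_op_degree_le: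
  assumes "degree p \<le> n"
  shows "poly_op p A = (\<Sum>k\<le>n. coeff p k *\<^sub>R (((o\<^sub>L) A ^^ k) id_blinfun))"
  unfolding poly_op_def using assms
  by (intro sum.mono_neutral_left) (auto simp: coeff_eq_0 not_le)

lemma poly_op_0 [simp]: "poly_op 0 A = 0"
  by (simp add: poly_op_def)

lemma poly_op_pCons [simp]: "poly_op (pCons a p) A = a *\<^sub>R id_blinfun + (A o\<^sub>L poly_op p A)"
proof -
  have "poly_op (pCons a p) A
      = (\<Sum>k\<le>Suc (degree p). coeff (pCons a p) k *\<^sub>R (((o\<^sub>L) A ^^ k) id_blinfun))"
    by (intro poly_op_degree_le degree_pCons_le)
  also have "\<dots> = a *\<^sub>R id_blinfun
      + (\<Sum>k\<le>degree p. coeff p k *\<^sub>R (A o\<^sub>L ((o\<^sub>L) A ^^ k) id_blinfun))"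
    by (subst sum.atMost_Suc_shift) simp
  also have "(\<Sum>k\<le>degree p. coeff p k *\<^sub>R (A o\<^sub>L ((o\<^sub>L) A ^^ k) id_blinfun)) = A o\<^sub>L poly_op p A"
    by (rule blinfun_eqI) (simp add: poly_op_def blinfun.sum_left blinfun.sum_right
        blinfun.scaleR_left blinfun.scaleR_right)
  finally show ?thesis .
qed

lemma poly_op_add: "poly_op (p + q) A = poly_op p A + poly_op q A"
proof (induction p q rule: poly_induct2)
  case (pCons a p b q)
  then show ?case
    by (intro blinfun_eqI) (simp add: blinfun.bilinear_simps scaleR_left_distrib)
qed simp

lemma poly_op_smult: "poly_op (smult c p) A = c *\<^sub>R poly_op p A"
  by (induction p) (auto intro!: blinfun_eqI simp: blinfun.bilinear_simps scaleR_right_distrib)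

lemma poly_op_diff: "poly_op (p - q) A = poly_op p A - poly_op q A"
  using poly_op_add[of "p - q" q A] by simp

lemma poly_op_mult: "poly_op (p * q) A = poly_op p A o\<^sub>L poly_op q A"
proof (induction p)
  case (pCons a p)
  then show ?case
    by (intro blinfun_eqI) (simp add: poly_op_add poly_op_smult blinfun.bilinear_simps)
qed (simp add: blinfun_eqI)

lemma poly_op_intertwine:
  assumes "A o\<^sub>L V = V o\<^sub>L B"
  shows "poly_op p A o\<^sub>L V = V o\<^sub>L poly_op p B"
proof (induction p)
  case (pCons a p)
  have A: "A (V x) = V (B x)" for x
    using assms by (metis blinfun_apply_blinfun_compose)
  have "poly_op p A (V x) = V (poly_op p B x)" for x
    using pCons by (metis blinfun_apply_blinfun_compose)
  then show ?case
    by (intro blinfun_eqI) (simp add: blinfun.bilinear_simps A)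
qed simp

lemma selfadjoint_poly_op:
  assumes A: "selfadjoint A"
  shows "selfadjoint (poly_op p A)"
proof (induction p)
  case (pCons a p)
  have "poly_op p A o\<^sub>L A = A o\<^sub>L poly_op p A"
    by (rule poly_op_intertwine) simp
  then have "selfadjoint (A o\<^sub>L poly_op p A)"
    using adjoint_pair_compose[of A A "poly_op p A" "poly_op p A"] A pCons
    by (simp add: selfadjoint_iff_adjoint_pair)
  then show ?case by (simp add: selfadjoint_add selfadjoint_scaleR selfadjoint_id)
qed (simp add: selfadjoint_zero)

section \<open>The norm of a polynomial of a self-adjoint operator\<close>

text \<open>The remainder of \<open>p\<close> modulo the quadratic polynomial with the roots \<open>z\<close> and \<open>cnj z\<close> is a real
polynomial of degree at most one with the nonreal root \<open>z\<close>, hence zero.\<close>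

lemma real_poly_quadratic_factor:
  fixes p :: "real poly"
  assumes root: "poly (map_poly complex_of_real p) z = 0" and im: "Im z \<noteq> 0"
  shows "[:(Re z)\<^sup>2 + (Im z)\<^sup>2, - 2 * Re z, 1:] dvd p"
proof -
  define ev where "ev p = poly (map_poly complex_of_real p) z" for p :: "real poly"
  have ev_pCons: "ev (pCons a p) = of_real a + z * ev p" for a p
    by (cases "pCons a p = 0") (auto simp: ev_def map_poly_pCons)
  have ev_0: "ev 0 = 0" by (simp add: ev_def)
  have ev_add: "ev (p + q) = ev p + ev q" for p q
    by (induction p q rule: poly_induct2) (auto simp: ev_pCons ev_0 algebra_simps)
  have ev_smult: "ev (smult a p) = of_real a * ev p" for a p
    by (induction p) (auto simp: ev_pCons ev_0 algebra_simps)
  have ev_mult: "ev (p * q) = ev p * ev q" for p q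
    by (induction p) (auto simp: ev_pCons ev_add ev_smult ev_0 algebra_simps)
  define d where "d = [:(Re z)\<^sup>2 + (Im z)\<^sup>2, - 2 * Re z, 1:]"
  have "ev d = 0"
    by (simp add: d_def ev_pCons ev_0 complex_eq_iff power2_eq_square algebra_simps)
  moreover have "p = d * (p div d) + p mod d" by simp
  ultimately have rem: "ev (p mod d) = 0"
    using root ev_add[of "d * (p div d)" "p mod d"] by (simp add: ev_mult flip: ev_def)
  have d: "d \<noteq> 0" "degree d = 2" by (simp_all add: d_def)
  define r where "r = p mod d"
  have "r = 0 \<or> degree r < 2" using degree_mod_less[OF d(1), of p] d(2) by (simp add: r_def)
  then have "degree r \<le> 1" by auto
  then have "r = [:coeff r 0, coeff r 1:]"
    by (intro poly_eqI) (auto simp: coeff_pCons coeff_eq_0 split: nat.split)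
  then obtain u v where r: "r = [:u, v:]" by blast
  have "of_real u + z * of_real v = 0" using rem by (simp add: r ev_pCons ev_0 flip: r_def)
  then have "v = 0" "u = 0" using im by (auto simp: complex_eq_iff)
  then have "p mod d = 0" using r by (simp add: r_def)
  then show ?thesis by (simp add: dvd_eq_mod_eq_0 d_def)
qed

text \<open>One half of the spectral mapping theorem. A real polynomial is a product of linear factors,
which are invertible at \<open>A\<close> because their roots avoid the spectrum, and of quadratic factors
\<open>(X - a)\<^sup>2 + b\<^sup>2\<close>, which are coercive at \<open>A\<close>.\<close>

lemma poly_op_invertible:
  assumes A: "selfadjoint A"
  shows "p \<noteq> 0 \<Longrightarrow> (\<And>t. complex_of_real t \<in> spectrum A \<Longrightarrow> poly p t \<noteq> 0)
    \<Longrightarrow> invertible_op (poly_op p A)"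
proof (induction "degree p" arbitrary: p rule: less_induct)
  case less
  show ?case
  proof (cases "degree p = 0")
    case True
    then obtain a where p: "p = [:a:]" by (rule degree_eq_zeroE)
    with less.prems(1) have "a \<noteq> 0" by simp
    then show ?thesis unfolding invertible_op_def p
      by (intro exI[of _ "inverse a *\<^sub>R id_blinfun"]) (auto intro!: blinfun_eqI simp: blinfun.bilinear_simps)
  next
    case False
    have "degree (map_poly complex_of_real p) = degree p"
      by (rule degree_map_poly) simp
    with False have "\<not> constant (poly (map_poly complex_of_real p))"
      by (simp add: constant_degree)
    from fundamental_theorem_of_algebra[OF this]
    obtain z where z: "poly (map_poly complex_of_real p) z = 0" by blast
    have step: "invertible_op (poly_op p A)"
      if dvd: "d dvd p" and deg: "0 < degree d" and inv: "invertible_op (poly_op d A)" for d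
    proof -
      obtain q where q: "p = d * q" using dvd by blast
      have "degree p = degree d + degree q"
        using less.prems(1) by (simp add: q degree_mult_eq)
      with deg have "degree q < degree p" by simp
      from less.hyps[OF this] less.prems have "invertible_op (poly_op q A)"
        by (auto simp: q)
      then show ?thesis by (simp add: q poly_op_mult invertible_op_compose inv)
    qed
    show ?thesis
    proof (cases "Im z = 0")
      case True
      then have zr: "z = complex_of_real (Re z)" by (simp add: complex_eq_iff)
      have "poly (map_poly complex_of_real q) (complex_of_real t) = complex_of_real (poly q t)" for q t
        by (induction q) (auto simp: map_poly_pCons)
      with z zr have root: "poly p (Re z) = 0" by (metis of_real_eq_0_iff)
      then have "complex_of_real (Re z) \<notin> spectrum A" using less.prems(2) by blast
      then have "invertible_op (poly_op [:- Re z, 1:] A)"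
        by (simp add: spectrum_def scalar_op_of_real)
      then show ?thesis
        by (intro step[of "[:- Re z, 1:]"]) (use root in \<open>auto simp: poly_eq_0_iff_dvd\<close>)
    next
      case False
      have eq: "poly_op [:(Re z)\<^sup>2 + (Im z)\<^sup>2, - 2 * Re z, 1:] A
          = (A o\<^sub>L A) - (2 * Re z) *\<^sub>R A + ((Re z)\<^sup>2 + (Im z)\<^sup>2) *\<^sub>R id_blinfun"
        by (rule blinfun_eqI) (simp add: blinfun.bilinear_simps)
      show ?thesis
      proof (rule step[OF real_poly_quadratic_factor[OF z False]])
        show "invertible_op (poly_op [:(Re z)\<^sup>2 + (Im z)\<^sup>2, - 2 * Re z, 1:] A)"
          unfolding eq by (rule selfadjoint_quadratic_invertible[OF A False])
      qed simp
    qed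
  qed
qed

text \<open>For unit vectors \<open>x\<close> with \<open>norm (B x)\<close> close to \<open>norm B\<close>, the vector \<open>(B\<^sup>2 - norm B ^ 2) x\<close> is
small; so an invertible \<open>B\<^sup>2 - norm B ^ 2\<close> forces the whole space to be trivial.\<close>

lemma selfadjoint_square_minus_norm_not_invertible:
  fixes B :: "'a::chilbert_space \<Rightarrow>\<^sub>L 'a"
  assumes B: "selfadjoint B" and inv: "invertible_op ((B o\<^sub>L B) - (norm B)\<^sup>2 *\<^sub>R id_blinfun)"
  shows "(x::'a) = 0"
proof -
  define c where "c = norm B"
  obtain k where k: "0 < k" "\<And>x. k * norm x \<le> norm (((B o\<^sub>L B) - (norm B)\<^sup>2 *\<^sub>R id_blinfun) x)"
    using invertible_op_bounded_below[OF inv] by blast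
  have main: "k\<^sup>2 * (norm x)\<^sup>2 \<le> c\<^sup>2 * (c\<^sup>2 * (norm x)\<^sup>2 - (norm (B x))\<^sup>2)" for x
  proof -
    have BB: "B (B x) \<bullet> x = B x \<bullet> B x" "x \<bullet> B (B x) = B x \<bullet> B x"
      by (simp_all add: selfadjoint_inner[OF B] inner_commute)
    have "k\<^sup>2 * (norm x)\<^sup>2 \<le> (norm (B (B x) - c\<^sup>2 *\<^sub>R x))\<^sup>2"
      using power_mono[OF k(2)[of x], of 2] k(1)
      by (simp add: blinfun.bilinear_simps c_def power_mult_distrib)
    also have "\<dots> = (norm (B (B x)))\<^sup>2 - 2 * c\<^sup>2 * (norm (B x))\<^sup>2 + c\<^sup>2 * c\<^sup>2 * (norm x)\<^sup>2"
      unfolding power2_norm_eq_inner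
      by (simp add: inner_diff_left inner_diff_right BB algebra_simps)
    also have "\<dots> \<le> c\<^sup>2 * (norm (B x))\<^sup>2 - 2 * c\<^sup>2 * (norm (B x))\<^sup>2 + c\<^sup>2 * c\<^sup>2 * (norm x)\<^sup>2"
      using power_mono[OF norm_blinfun[of B "B x"], of 2] by (simp add: c_def power_mult_distrib)
    finally show ?thesis by (simp add: algebra_simps)
  qed
  show ?thesis
  proof (cases "c = 0")
    case True
    with main[of x] k(1) show ?thesis by (simp add: mult_le_0_iff)
  next
    case False
    then have c: "0 < c" by (simp add: c_def)
    define e where "e = c\<^sup>2 - k\<^sup>2 / c\<^sup>2"
    have e: "(norm (B x))\<^sup>2 \<le> e * (norm x)\<^sup>2" for x
      using main[of x] c by (simp add: e_def field_simps power2_eq_square)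
    have "norm B \<le> sqrt (max 0 e)"
    proof (rule norm_blinfun_bound)
      fix x
      have "(norm (B x))\<^sup>2 \<le> max 0 e * (norm x)\<^sup>2"
        using e[of x] by (meson max.cobounded2 mult_right_mono order_trans zero_le_power2)
      then have "(norm (B x))\<^sup>2 \<le> (sqrt (max 0 e) * norm x)\<^sup>2"
        by (simp add: power_mult_distrib)
      then show "norm (B x) \<le> sqrt (max 0 e) * norm x"
        by (rule power2_le_imp_le) simp
    qed simp
    then have "c\<^sup>2 \<le> max 0 e"
      using power_mono[of c "sqrt (max 0 e)" 2] c by (simp add: c_def)
    moreover have "e < c\<^sup>2" using c k(1) by (simp add: e_def)
    ultimately show ?thesis using c by (auto simp: max_def split: if_splits)
  qed
qed

text \<open>By the previous lemma the polynomial \<open>X\<^sup>2 - norm A ^ 2\<close> must have a root in the spectrum.\<close>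

lemma spectrum_nonempty:
  fixes A :: "'a::chilbert_space \<Rightarrow>\<^sub>L 'a" and x :: 'a
  assumes A: "selfadjoint A" and x: "x \<noteq> 0"
  shows "\<exists>t. complex_of_real t \<in> spectrum A"
proof (rule ccontr)
  assume "\<nexists>t. complex_of_real t \<in> spectrum A"
  then have "invertible_op (poly_op [:- (norm A)\<^sup>2, 0, 1:] A)"
    by (intro poly_op_invertible[OF A]) auto
  also have "poly_op [:- (norm A)\<^sup>2, 0, 1:] A = (A o\<^sub>L A) - (norm A)\<^sup>2 *\<^sub>R id_blinfun"
    by (rule blinfun_eqI) (simp add: blinfun.bilinear_simps)
  finally show False
    using selfadjoint_square_minus_norm_not_invertible[OF A] x by blast
qed

text \<open>If \<open>B = poly_op p A\<close> had norm \<open>c > e\<close>, then \<open>p\<^sup>2 - c\<^sup>2\<close> would have no root in the spectrum,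
so \<open>B\<^sup>2 - c\<^sup>2\<close> would be invertible, which is impossible for a self-adjoint \<open>B\<close> of norm \<open>c\<close>.\<close>

lemma norm_poly_op_le:
  fixes A :: "'a::chilbert_space \<Rightarrow>\<^sub>L 'a"
  assumes A: "selfadjoint A" and e: "0 \<le> e"
    and bound: "\<And>t. complex_of_real t \<in> spectrum A \<Longrightarrow> \<bar>poly p t\<bar> \<le> e"
  shows "norm (poly_op p A) \<le> e"
proof (rule ccontr)
  define c where "c = norm (poly_op p A)"
  assume "\<not> norm (poly_op p A) \<le> e"
  then have c: "e < c" by (simp add: c_def)
  have "\<exists>x::'a. x \<noteq> 0"
  proof (rule ccontr)
    assume "\<nexists>x::'a. x \<noteq> 0"
    then have "poly_op p A = 0" by (auto intro: blinfun_eqI)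
    with c e show False by (simp add: c_def)
  qed
  then obtain x :: 'a where x: "x \<noteq> 0" by blast
  define q where "q = p * p - [:c\<^sup>2:]"
  have nz: "poly q t \<noteq> 0" if "complex_of_real t \<in> spectrum A" for t
  proof -
    have "(poly p t)\<^sup>2 \<le> e\<^sup>2" using bound[OF that] e by (metis abs_le_square_iff abs_of_nonneg)
    also have "\<dots> < c\<^sup>2" using c e by (intro power_strict_mono) auto
    finally show ?thesis by (simp add: q_def power2_eq_square)
  qed
  with spectrum_nonempty[OF A x] have "q \<noteq> 0" by auto
  then have "invertible_op (poly_op q A)" by (rule poly_op_invertible[OF A _ nz])
  also have "poly_op q A = (poly_op p A o\<^sub>L poly_op p A) - c\<^sup>2 *\<^sub>R id_blinfun"
    by (simp add: q_def poly_op_diff poly_op_mult)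
  finally show False
    using selfadjoint_square_minus_norm_not_invertible[OF selfadjoint_poly_op[OF A]] x
    by (auto simp: c_def)
qed

section \<open>The continuous functional calculus\<close>

instance chilbert_space \<subseteq> banach ..

lemma polynomials_uniformly_approximate:
  fixes f :: "real \<Rightarrow> real"
  assumes f: "continuous_on {a..b} f"
  obtains p where "uniform_limit {a..b} (\<lambda>n. poly (p n)) f sequentially"
proof -
  have "\<exists>p. \<forall>t\<in>{a..b}. \<bar>f t - poly p t\<bar> < inverse (real (Suc n))" for n
  proof -
    obtain g where g: "real_polynomial_function g"
      "\<And>t. t \<in> {a..b} \<Longrightarrow> \<bar>f t - g t\<bar> < inverse (real (Suc n))"
      using Stone_Weierstrass_real_polynomial_function[OF compact_Icc f, of "inverse (real (Suc n))"]
      by auto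
    obtain c N where c: "g = (\<lambda>t. \<Sum>i\<le>N. c i * t ^ i)"
      using g(1) by (auto simp: real_polynomial_function_iff_sum)
    have "poly (\<Sum>i\<le>N. monom (c i) i) t = g t" for t
      by (simp add: c poly_sum poly_monom)
    with g(2) show ?thesis by metis
  qed
  then obtain p where p: "\<And>n t. t \<in> {a..b} \<Longrightarrow> \<bar>f t - poly (p n) t\<bar> < inverse (real (Suc n))"
    by metis
  have "uniform_limit {a..b} (\<lambda>n. poly (p n)) f sequentially"
  proof (rule uniform_limitI)
    fix e :: real assume "0 < e"
    then have "\<forall>\<^sub>F n in sequentially. inverse (real (Suc n)) < e"
      using LIMSEQ_inverse_real_of_nat by (rule order_tendstoD(2)[rotated])
    then show "\<forall>\<^sub>F n in sequentially. \<forall>t\<in>{a..b}. dist (poly (p n) t) (f t) < e"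
    proof eventually_elim
      case (elim n)
      show ?case
        using less_trans[OF p elim] by (simp add: dist_real_def abs_minus_commute)
    qed
  qed
  then show ?thesis using that by blast
qed

context
  fixes A :: "'a::chilbert_space \<Rightarrow>\<^sub>L 'a" and a b :: real
  assumes A: "selfadjoint A" and spec: "spectrum_in A {a..b}"
begin

lemma spectrum_subset_interval: "{t. complex_of_real t \<in> spectrum A} \<subseteq> {a..b}"
  using spec by auto

lemma norm_poly_op_diff_le:
  assumes "0 \<le> e" "\<And>t. complex_of_real t \<in> spectrum A \<Longrightarrow> \<bar>poly p t - poly q t\<bar> \<le> e"
  shows "norm (poly_op p A - poly_op q A) \<le> e"
  unfolding poly_op_diff[symmetric] using assms by (intro norm_poly_op_le[OF A]) auto

text \<open>Since \<open>norm (q(A))\<close> is at most the supremum of \<open>|q|\<close> on the spectrum, the operators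
\<open>p n(A)\<close> form a Cauchy sequence whose limit does not depend on the approximating polynomials.\<close>

lemma fun_calc_limit:
  assumes f: "continuous_on {a..b} f"
    and p: "uniform_limit {t. complex_of_real t \<in> spectrum A} (\<lambda>n. poly (p n)) f sequentially"
  shows "(\<lambda>n. poly_op (p n) A) \<longlonglongrightarrow> fun_calc f A"
proof -
  define S where "S = {t. complex_of_real t \<in> spectrum A}"
  note p = p[folded S_def]
  have "Cauchy (\<lambda>n. poly_op (p n) A)"
  proof (rule metric_CauchyI)
    fix e :: real assume e: "0 < e"
    then obtain N where N: "\<And>n t. n \<ge> N \<Longrightarrow> t \<in> S \<Longrightarrow> dist (poly (p n) t) (f t) < e / 4"
      using uniform_limitD[OF p, of "e / 4"] by (auto simp: eventually_sequentially)
    have "dist (poly_op (p m) A) (poly_op (p n) A) < e" if "m \<ge> N" "n \<ge> N" for m n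
    proof -
      have "norm (poly_op (p m) A - poly_op (p n) A) \<le> e / 2"
      proof (rule norm_poly_op_diff_le)
        fix t assume "complex_of_real t \<in> spectrum A"
        then have "t \<in> S" by (simp add: S_def)
        with N[OF that(1)] N[OF that(2)] show "\<bar>poly (p m) t - poly (p n) t\<bar> \<le> e / 2"
          by (fastforce simp: dist_real_def abs_if split: if_splits)
      qed (use e in simp)
      with e show ?thesis by (simp add: dist_norm)
    qed
    then show "\<exists>N. \<forall>m\<ge>N. \<forall>n\<ge>N. dist (poly_op (p m) A) (poly_op (p n) A) < e" by blast
  qed
  then obtain B where B: "(\<lambda>n. poly_op (p n) A) \<longlonglongrightarrow> B"
    by (auto simp: Cauchy_convergent_iff convergent_def)
  have lim: "(\<lambda>n. poly_op (q n) A) \<longlonglongrightarrow> B"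
    if q: "uniform_limit S (\<lambda>n. poly (q n)) f sequentially" for q
  proof -
    have "(\<lambda>n. poly_op (q n) A - poly_op (p n) A) \<longlonglongrightarrow> 0"
    proof (rule tendstoI)
      fix e :: real assume e: "0 < e"
      then have "0 < e / 4" by simp
      from uniform_limitD[OF p this] uniform_limitD[OF q this]
      show "\<forall>\<^sub>F n in sequentially. dist (poly_op (q n) A - poly_op (p n) A) 0 < e"
      proof eventually_elim
        case (elim n)
        have "norm (poly_op (q n) A - poly_op (p n) A) \<le> e / 2"
        proof (rule norm_poly_op_diff_le)
          fix t assume "complex_of_real t \<in> spectrum A"
          then have "t \<in> S" by (simp add: S_def)
          with elim show "\<bar>poly (q n) t - poly (p n) t\<bar> \<le> e / 2"
            by (fastforce simp: dist_real_def abs_if split: if_splits)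
        qed (use e in simp)
        with e show ?case by simp
      qed
    qed
    from tendsto_add[OF this B] show ?thesis by simp
  qed
  have "fun_calc f A = B"
    unfolding fun_calc_def S_def[symmetric]
    by (rule the_equality) (use lim p B LIMSEQ_unique in blast)+
  then show ?thesis using B by simp
qed

lemma fun_calc_limit_interval:
  assumes "continuous_on {a..b} f" "uniform_limit {a..b} (\<lambda>n. poly (p n)) f sequentially"
  shows "(\<lambda>n. poly_op (p n) A) \<longlonglongrightarrow> fun_calc f A"
  using assms(2) spectrum_subset_interval
  by (intro fun_calc_limit[OF assms(1)]) (rule uniform_limit_on_subset)

lemma selfadjoint_fun_calc:
  assumes f: "continuous_on {a..b} f"
  shows "selfadjoint (fun_calc f A)"
proof -
  obtain p where "uniform_limit {a..b} (\<lambda>n. poly (p n)) f sequentially"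
    using polynomials_uniformly_approximate[OF f] by blast
  from fun_calc_limit_interval[OF f this] show ?thesis
    by (rule selfadjoint_limit[rotated]) (rule selfadjoint_poly_op[OF A])
qed

lemma fun_calc_poly: "fun_calc (poly q) A = poly_op q A"
proof -
  have "(\<lambda>n. poly_op q A) \<longlonglongrightarrow> fun_calc (poly q) A"
    by (rule fun_calc_limit) (auto intro!: continuous_intros uniform_limit_const)
  then show ?thesis by (simp add: LIMSEQ_const_iff)
qed

lemma fun_calc_cong:
  assumes f: "continuous_on {a..b} f" and eq: "\<And>t. t \<in> {a..b} \<Longrightarrow> f t = g t"
  shows "fun_calc f A = fun_calc g A"
proof -
  obtain p where p: "uniform_limit {a..b} (\<lambda>n. poly (p n)) f sequentially"
    using polynomials_uniformly_approximate[OF f] by blast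
  have g: "continuous_on {a..b} g"
    using f eq continuous_on_cong[OF refl, of "{a..b}" f g] by blast
  have "uniform_limit {a..b} (\<lambda>n. poly (p n)) g sequentially"
    using p by (simp add: uniform_limit_iff eq)
  from LIMSEQ_unique[OF fun_calc_limit_interval[OF f p] fun_calc_limit_interval[OF g this]]
  show ?thesis .
qed

lemma fun_calc_mult:
  assumes f: "continuous_on {a..b} f" and g: "continuous_on {a..b} g"
  shows "fun_calc (\<lambda>t. f t * g t) A = fun_calc f A o\<^sub>L fun_calc g A"
proof -
  obtain p where p: "uniform_limit {a..b} (\<lambda>n. poly (p n)) f sequentially"
    using polynomials_uniformly_approximate[OF f] by blast
  obtain q where q: "uniform_limit {a..b} (\<lambda>n. poly (q n)) g sequentially"
    using polynomials_uniformly_approximate[OF g] by blast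
  have "bounded (f ` {a..b})" "bounded (g ` {a..b})"
    using f g by (auto intro: compact_imp_bounded compact_continuous_image)
  then have "uniform_limit {a..b} (\<lambda>n t. poly (p n) t * poly (q n) t) (\<lambda>t. f t * g t) sequentially"
    by (intro bounded_bilinear.bounded_uniform_limit[OF bounded_bilinear_mult] p q)
  then have "uniform_limit {a..b} (\<lambda>n. poly (p n * q n)) (\<lambda>t. f t * g t) sequentially"
    by (simp add: poly_mult[abs_def])
  then have "(\<lambda>n. poly_op (p n * q n) A) \<longlonglongrightarrow> fun_calc (\<lambda>t. f t * g t) A"
    using f g by (intro fun_calc_limit_interval) (auto intro!: continuous_intros)
  moreover have "(\<lambda>n. poly_op (p n * q n) A) \<longlonglongrightarrow> (fun_calc f A o\<^sub>L fun_calc g A)"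
    unfolding poly_op_mult
    by (intro bounded_bilinear.tendsto[OF bounded_bilinear_blinfun_compose]
        fun_calc_limit_interval f g p q)
  ultimately show ?thesis by (rule LIMSEQ_unique)
qed

lemma fun_calc_poly_close:
  assumes f: "continuous_on {a..b} f" and e: "0 \<le> e"
    and close: "\<And>t. t \<in> {a..b} \<Longrightarrow> \<bar>poly q t - f t\<bar> \<le> e"
  shows "norm (poly_op q A - fun_calc f A) \<le> e"
proof (rule field_le_epsilon)
  fix d :: real assume d: "0 < d"
  obtain p where p: "uniform_limit {a..b} (\<lambda>n. poly (p n)) f sequentially"
    using polynomials_uniformly_approximate[OF f] by blast
  have lim: "(\<lambda>n. norm (poly_op q A - poly_op (p n) A)) \<longlonglongrightarrow> norm (poly_op q A - fun_calc f A)"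
    by (intro tendsto_intros fun_calc_limit_interval f p)
  have "\<forall>\<^sub>F n in sequentially. norm (poly_op q A - poly_op (p n) A) \<le> e + d"
    using uniform_limitD[OF p d]
  proof eventually_elim
    case (elim n)
    show ?case
    proof (rule norm_poly_op_diff_le)
      fix t assume "complex_of_real t \<in> spectrum A"
      then have "t \<in> {a..b}" using spectrum_subset_interval by auto
      with elim close show "\<bar>poly q t - poly (p n) t\<bar> \<le> e + d"
        by (fastforce simp: dist_real_def abs_if split: if_splits)
    qed (use e d in simp)
  qed
  with lim show "norm (poly_op q A - fun_calc f A) \<le> e + d"
    by (rule tendsto_upperbound) simp
qed

end

text \<open>The main tool for computing \<open>f(A)\<close>: the relation holds for polynomials and survives the limit.
Taking for \<open>V\<close> an isometry, a reflection or an inclusion relates \<open>f(A)\<close> to \<open>f\<close> of a restriction of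
\<open>A\<close>.\<close>

lemma fun_calc_intertwine:
  assumes A: "selfadjoint A" "spectrum_in A {a..b}" and B: "selfadjoint B" "spectrum_in B {a..b}"
    and f: "continuous_on {a..b} f" and V: "A o\<^sub>L V = V o\<^sub>L B"
  shows "fun_calc f A o\<^sub>L V = V o\<^sub>L fun_calc f B"
proof -
  obtain p where p: "uniform_limit {a..b} (\<lambda>n. poly (p n)) f sequentially"
    using polynomials_uniformly_approximate[OF f] by blast
  have "(\<lambda>n. poly_op (p n) A o\<^sub>L V) \<longlonglongrightarrow> (fun_calc f A o\<^sub>L V)"
    by (intro bounded_bilinear.tendsto[OF bounded_bilinear_blinfun_compose] tendsto_const
        fun_calc_limit_interval[OF A] f p)
  moreover have "(\<lambda>n. V o\<^sub>L poly_op (p n) B) \<longlonglongrightarrow> (V o\<^sub>L fun_calc f B)"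
    by (intro bounded_bilinear.tendsto[OF bounded_bilinear_blinfun_compose] tendsto_const
        fun_calc_limit_interval[OF B] f p)
  ultimately show ?thesis
    unfolding poly_op_intertwine[OF V] by (rule LIMSEQ_unique)
qed

text \<open>With \<open>c = norm A\<close>, the polynomial \<open>c - X\<close> takes values in \<open>{0..c}\<close> on the spectrum, so
\<open>norm (c - A) \<le> c\<close>, and the quadratic form of \<open>c - A\<close> is at most that of \<open>c\<close>.\<close>

lemma spectrum_nonneg_imp_positive_op:
  fixes A :: "'a::chilbert_space \<Rightarrow>\<^sub>L 'a"
  assumes A: "selfadjoint A" and spec: "spectrum_in A {0..}"
  shows "positive_op A"
proof -
  define c where "c = norm A"
  have "spectrum_in A {- c..c}"
    using quadratic_form_le_norm[of _ A]
    by (intro spectrum_in_quadratic_form_bounds[OF A]) (auto simp: abs_le_iff c_def minus_le_iff)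
  with spec have t: "0 \<le> t" "t \<le> c" if "complex_of_real t \<in> spectrum A" for t
    using that by auto
  have "norm (poly_op [:c, -1:] A) \<le> c"
    using t by (intro norm_poly_op_le[OF A]) (auto simp: c_def)
  moreover have "poly_op [:c, -1:] A = c *\<^sub>R id_blinfun - A"
    by (rule blinfun_eqI) (simp add: blinfun.bilinear_simps)
  ultimately have n: "norm (c *\<^sub>R id_blinfun - A) \<le> c" by simp
  have "0 \<le> x \<bullet> A x" for x
  proof -
    have "x \<bullet> (c *\<^sub>R id_blinfun - A) x \<le> c * (norm x)\<^sup>2"
      using quadratic_form_le_norm[of x "c *\<^sub>R id_blinfun - A"] mult_right_mono[OF n, of "(norm x)\<^sup>2"]
      by simp
    then show ?thesis
      by (simp add: blinfun.bilinear_simps inner_diff_right power2_norm_eq_inner)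
  qed
  with A show ?thesis by (simp add: positive_op_iff)
qed

section \<open>Square roots of strictly positive operators\<close>

text \<open>A positive operator satisfies \<open>norm (R x) ^ 2 \<le> norm R * (x \<bullet> R x)\<close>, so that being bounded
below and being coercive are the same.\<close>

lemma positive_op_norm_square_le:
  assumes R: "positive_op R"
  shows "(norm (R x))\<^sup>2 \<le> norm R * (x \<bullet> R x)"
proof (cases "R = 0")
  case False
  define s where "s = 1 / norm R"
  have sa: "selfadjoint R" and pos: "\<And>y. 0 \<le> y \<bullet> R y" using R by (auto simp: positive_op_iff)
  have xR: "x \<bullet> R (R x) = R x \<bullet> R x" by (simp add: selfadjoint_inner[OF sa, of x "R x", symmetric])
  have "0 \<le> (x - s *\<^sub>R R x) \<bullet> R (x - s *\<^sub>R R x)" by (rule pos)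
  also have "\<dots> = x \<bullet> R x - 2 * s * (R x \<bullet> R x) + s\<^sup>2 * (R x \<bullet> R (R x))"
    by (simp add: blinfun.bilinear_simps inner_diff_left inner_diff_right xR power2_eq_square algebra_simps)
  also have "\<dots> \<le> x \<bullet> R x - 2 * s * (R x \<bullet> R x) + s\<^sup>2 * (norm R * (norm (R x))\<^sup>2)"
    using quadratic_form_le_norm[of "R x" R] by (intro add_left_mono mult_left_mono) auto
  also have "\<dots> = x \<bullet> R x - (norm (R x))\<^sup>2 / norm R"
    using False by (simp add: s_def dot_square_norm power2_eq_square field_simps)
  finally show ?thesis using False by (simp add: field_simps)
qed simp

lemma strictly_positive_iff:
  "strictly_positive R \<longleftrightarrow> selfadjoint R \<and> (\<exists>m>0. \<forall>x. m * (norm x)\<^sup>2 \<le> x \<bullet> R x)"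
proof
  assume R: "strictly_positive R"
  then have pos: "positive_op R" and sa: "selfadjoint R"
    by (auto simp: strictly_positive_def positive_op_iff)
  obtain k where k: "0 < k" "\<And>x. k * norm x \<le> norm (R x)"
    using R invertible_op_bounded_below unfolding strictly_positive_def by metis
  have "k\<^sup>2 / (norm R + 1) * (norm x)\<^sup>2 \<le> x \<bullet> R x" for x
  proof -
    have "k\<^sup>2 * (norm x)\<^sup>2 \<le> (norm (R x))\<^sup>2"
      using power_mono[OF k(2)[of x], of 2] k(1) by (simp add: power_mult_distrib)
    also have "\<dots> \<le> norm R * (x \<bullet> R x)" by (rule positive_op_norm_square_le[OF pos])
    also have "\<dots> \<le> (norm R + 1) * (x \<bullet> R x)"
      using pos by (simp add: positive_op_iff distrib_right)
    finally show ?thesis by (simp add: divide_le_eq add_nonneg_pos mult.commute)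
  qed
  moreover have "0 < k\<^sup>2 / (norm R + 1)" using k(1) by (simp add: add_nonneg_pos)
  ultimately show "selfadjoint R \<and> (\<exists>m>0. \<forall>x. m * (norm x)\<^sup>2 \<le> x \<bullet> R x)" using sa by blast
next
  assume "selfadjoint R \<and> (\<exists>m>0. \<forall>x. m * (norm x)\<^sup>2 \<le> x \<bullet> R x)"
  then obtain m where sa: "selfadjoint R" and m: "0 < m" "\<And>x. m * (norm x)\<^sup>2 \<le> x \<bullet> R x" by blast
  have "0 \<le> x \<bullet> R x" for x
    using m(2)[of x] m(1) by (meson less_imp_le mult_nonneg_nonneg order_trans zero_le_power2)
  with sa show "strictly_positive R"
    using coercive_imp_invertible[OF m] by (simp add: strictly_positive_def positive_op_iff)
qed

lemma powr_op_facts: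
  fixes R :: "'a::chilbert_space \<Rightarrow>\<^sub>L 'a"
  assumes R: "strictly_positive R"
  shows selfadjoint_powr_op: "selfadjoint (powr_op R r)"
    and powr_op_half_square: "powr_op R (1/2) o\<^sub>L powr_op R (1/2) = R"
    and powr_op_half_inverse_left: "powr_op R (-1/2) o\<^sub>L powr_op R (1/2) = id_blinfun"
    and powr_op_half_inverse_right: "powr_op R (1/2) o\<^sub>L powr_op R (-1/2) = id_blinfun"
proof -
  obtain m where sa: "selfadjoint R" and m: "0 < m" "\<And>x. m * (norm x)\<^sup>2 \<le> x \<bullet> R x"
    using R by (auto simp: strictly_positive_iff)
  have "x \<bullet> R x \<le> norm R * (norm x)\<^sup>2" for x
    using quadratic_form_le_norm[of x R] by simp
  from spectrum_in_quadratic_form_bounds[OF sa m(2) this]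
  have spec: "spectrum_in R {m..norm R}" .
  have cont: "continuous_on {m..norm R} (\<lambda>t. t powr r)" for r
    using m(1) by (intro continuous_intros) auto
  show "selfadjoint (powr_op R r)" for r
    unfolding powr_op_def by (rule selfadjoint_fun_calc[OF sa spec cont])
  have mult: "powr_op R r o\<^sub>L powr_op R s = fun_calc (\<lambda>t. t powr (r + s)) R" for r s
    unfolding powr_op_def fun_calc_mult[OF sa spec cont cont, symmetric] by (simp add: powr_add)
  have one: "fun_calc (\<lambda>t. t powr 0) R = id_blinfun"
    using fun_calc_cong[OF sa spec cont[of 0], of "poly [:1:]"] fun_calc_poly[OF sa spec, of "[:1:]"] m(1)
    by simp
  have ident: "fun_calc (\<lambda>t. t powr 1) R = R"
    using fun_calc_cong[OF sa spec cont[of 1], of "poly [:0, 1:]"] fun_calc_poly[OF sa spec, of "[:0, 1:]"] m(1)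
    by (simp del: powr_one')
  show "powr_op R (1/2) o\<^sub>L powr_op R (1/2) = R" using mult ident by simp
  show "powr_op R (-1/2) o\<^sub>L powr_op R (1/2) = id_blinfun" using mult one by simp
  show "powr_op R (1/2) o\<^sub>L powr_op R (-1/2) = id_blinfun" using mult one by simp
qed

section \<open>The order on operators\<close>

lemma positive_op_add: "positive_op A \<Longrightarrow> positive_op B \<Longrightarrow> positive_op (A + B)"
  by (simp add: positive_op_iff selfadjoint_add blinfun.add_left inner_add_right)

lemma positive_op_scaleR: "0 \<le> r \<Longrightarrow> positive_op A \<Longrightarrow> positive_op (r *\<^sub>R A)"
  by (simp add: positive_op_iff selfadjoint_scaleR blinfun.scaleR_left)

lemma positive_op_zero: "positive_op 0"
  by (simp add: positive_op_iff selfadjoint_zero)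

lemma positive_op_sum: "(\<And>i. i \<in> S \<Longrightarrow> positive_op (A i)) \<Longrightarrow> positive_op (\<Sum>i\<in>S. A i)"
  by (induction S rule: infinite_finite_induct) (auto intro: positive_op_add positive_op_zero)

lemma positive_op_conj:
  assumes "adjoint_pair W W'" "positive_op A"
  shows "positive_op (W' o\<^sub>L A o\<^sub>L W)"
  using assms selfadjoint_conj[OF assms(1)] adjoint_pair_inner[OF assms(1), symmetric]
  by (simp add: positive_op_iff)

lemma op_le_refl: "X \<preceq> X"
  by (simp add: op_le_def positive_op_zero)

lemma op_le_trans: "X \<preceq> Y \<Longrightarrow> Y \<preceq> Z \<Longrightarrow> X \<preceq> Z"
  unfolding op_le_def using positive_op_add[of "Y - X" "Z - Y"] by simp

lemma op_le_add: "X \<preceq> Y \<Longrightarrow> X' \<preceq> Y' \<Longrightarrow> X + X' \<preceq> Y + Y'"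
  unfolding op_le_def using positive_op_add[of "Y - X" "Y' - X'"] by (simp add: algebra_simps)

lemma op_le_sum: "(\<And>i. i \<in> S \<Longrightarrow> X i \<preceq> Y i) \<Longrightarrow> (\<Sum>i\<in>S. X i) \<preceq> (\<Sum>i\<in>S. Y i)"
  unfolding op_le_def using positive_op_sum[of S "\<lambda>i. Y i - X i"] by (simp add: sum_subtractf)

lemma op_le_conj:
  assumes "adjoint_pair W W'" "X \<preceq> Y"
  shows "W' o\<^sub>L X o\<^sub>L W \<preceq> W' o\<^sub>L Y o\<^sub>L W"
proof -
  have "(W' o\<^sub>L Y o\<^sub>L W) - (W' o\<^sub>L X o\<^sub>L W) = W' o\<^sub>L (Y - X) o\<^sub>L W"
    by (rule blinfun_eqI) (simp add: blinfun.bilinear_simps)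
  then show ?thesis
    using positive_op_conj[OF assms(1)] assms(2) by (simp add: op_le_def)
qed

section \<open>Finite-dimensional pieces of a Hilbert space inside \<open>ell2\<close>\<close>

lemma cmod_cinner_le: "cmod (cinner x y) \<le> norm x * norm y" for x y :: "'a::chilbert_space"
proof -
  define c where "c = cinner x y"
  have "(c *\<^sub>C x) \<bullet> y = Re (cnj c * c)"
    by (simp add: inner_eq_Re_cinner cinner_scaleC_left c_def)
  also have "\<dots> = cmod c * cmod c"
    by (simp add: cmod_power2 flip: power2_eq_square)
  finally have "cmod c * cmod c \<le> cmod c * (norm x * norm y)"
    using norm_cauchy_schwarz[of "c *\<^sub>C x" y] by (simp add: norm_scaleC mult.assoc)
  then have "cmod c \<le> norm x * norm y" by (cases "c = 0") auto
  then show ?thesis by (simp add: c_def)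
qed

definition rank_one :: "'a::chilbert_space \<Rightarrow> 'b::chilbert_space \<Rightarrow> ('b \<Rightarrow>\<^sub>L 'a)" where
  "rank_one e u = Blinfun (\<lambda>y. cinner u y *\<^sub>C e)"

lemma rank_one_apply: "rank_one e u y = cinner u y *\<^sub>C e"
proof -
  have "bounded_linear (\<lambda>y. cinner u y *\<^sub>C e)"
  proof (rule bounded_linear_intro[where K = "norm u * norm e"])
    show "norm (cinner u y *\<^sub>C e) \<le> norm y * (norm u * norm e)" for y
      using mult_right_mono[OF cmod_cinner_le[of u y], of "norm e"] by (simp add: norm_scaleC mult_ac)
    show "cinner u (r *\<^sub>R y) *\<^sub>C e = r *\<^sub>R (cinner u y *\<^sub>C e)" for r y
      by (simp add: cinner_scaleR_right flip: scaleC_scaleC scaleC_of_real[of r "cinner u y *\<^sub>C e"])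
  qed (simp add: cinner_add_right scaleC_add_left)
  then show ?thesis by (simp add: rank_one_def bounded_linear_Blinfun_apply)
qed

lemma adjoint_pair_rank_one: "adjoint_pair (rank_one e u) (rank_one u e)"
  unfolding adjoint_pair_def rank_one_apply cinner_scaleC_left cinner_scaleC_right
  by (metis cinner_commute mult.commute)

definition orthonormal :: "nat \<Rightarrow> (nat \<Rightarrow> 'a::chilbert_space) \<Rightarrow> bool" where
  "orthonormal m e \<longleftrightarrow> (\<forall>i<m. \<forall>j<m. cinner (e i) (e j) = of_bool (i = j))"

lemma orthonormal_coordinate:
  assumes "orthonormal m e" "i < m"
  shows "cinner (e i) (\<Sum>j<m. c j *\<^sub>C e j) = c i"
proof -
  have "cinner (e i) (\<Sum>j<m. c j *\<^sub>C e j) = (\<Sum>j<m. if j = i then c j else 0)"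
    unfolding cinner_sum_right using assms
    by (intro sum.cong) (auto simp: orthonormal_def cinner_scaleC_right)
  then show ?thesis using assms(2) by simp
qed

definition ell2_unit :: "nat \<Rightarrow> ell2" where
  "ell2_unit i = Abs_ell2 (\<lambda>n. of_bool (n = i))"

lemma ell2_coord_unit: "ell2_coord (ell2_unit i) = (\<lambda>n. of_bool (n = i))"
proof -
  have "(\<lambda>n. (cmod (of_bool (n = i)))\<^sup>2) = (\<lambda>n. if n = i then 1 else 0)" by auto
  then have "square_summable (\<lambda>n. of_bool (n = i))"
    unfolding square_summable_def using sums_single[of i "\<lambda>_. 1 :: real"] by (auto simp: sums_iff)
  then show ?thesis by (simp add: ell2_unit_def Abs_ell2_inverse)
qed

lemma orthonormal_ell2_unit: "orthonormal m ell2_unit"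
proof -
  have "cinner (ell2_unit i) (ell2_unit j) = of_bool (i = j)" for i j
  proof -
    have "(\<lambda>n. cnj (of_bool (n = i)) * of_bool (n = j))
        = (\<lambda>n. if n = i then of_bool (i = j) else 0 :: complex)" by auto
    then show ?thesis
      using sums_single[of i "\<lambda>_. of_bool (i = j) :: complex"]
      by (simp add: cinner_ell2_def ell2_cinner.rep_eq ell2_coord_unit sums_iff)
  qed
  then show ?thesis by (simp add: orthonormal_def)
qed

lemma gram_schmidt:
  fixes S :: "'a::chilbert_space set"
  assumes "finite S"
  shows "\<exists>m e. orthonormal m e \<and> (\<forall>v\<in>S. v = (\<Sum>i<m. cinner (e i) v *\<^sub>C e i))"
  using assms
proof induction
  case empty
  show ?case by (intro exI[of _ 0]) (simp add: orthonormal_def)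
next
  case (insert w S)
  then obtain m e where e: "orthonormal m e"
    and exp: "\<And>v. v \<in> S \<Longrightarrow> v = (\<Sum>i<m. cinner (e i) v *\<^sub>C e i)" by blast
  define u where "u = w - (\<Sum>i<m. cinner (e i) w *\<^sub>C e i)"
  have w: "w = (\<Sum>i<m. cinner (e i) w *\<^sub>C e i) + u" by (simp add: u_def)
  show ?case
  proof (cases "u = 0")
    case True
    with w e exp show ?thesis by (intro exI[of _ m] exI[of _ e]) auto
  next
    case False
    define e' where "e' = (\<lambda>i. if i < m then e i else inverse (norm u) *\<^sub>R u)"
    have eu: "cinner (e i) u = 0" if "i < m" for i
      using orthonormal_coordinate[OF e that] by (simp add: u_def cinner_diff_right)
    then have ue: "cinner u (e i) = 0" if "i < m" for i
      using that by (metis cinner_commute complex_cnj_zero)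
    have uu: "cinner u u = of_real (norm u) * of_real (norm u)"
      by (simp add: cinner_self power2_eq_square)
    have unit: "inverse r * (inverse r * (r * r)) = 1" if "r \<noteq> 0" for r :: complex
      using that by (simp add: field_simps)
    have e': "orthonormal (Suc m) e'"
      using e eu ue False
      by (auto simp: orthonormal_def e'_def cinner_scaleR_left cinner_scaleR_right uu unit less_Suc_eq)
    have u_span: "cinner u (\<Sum>i<m. c i *\<^sub>C e i) = 0" for c
      by (simp add: cinner_sum_right cinner_scaleC_right ue)
    have sum: "(\<Sum>i<Suc m. cinner (e' i) v *\<^sub>C e' i)
        = (\<Sum>i<m. cinner (e i) v *\<^sub>C e i) + cinner (e' m) v *\<^sub>C e' m" for v
      by (simp add: e'_def)
    have "v = (\<Sum>i<Suc m. cinner (e' i) v *\<^sub>C e' i)" if "v \<in> S" for v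
    proof -
      have "cinner u v = 0" by (subst exp[OF that]) (rule u_span)
      then have "cinner (e' m) v = 0" by (simp add: e'_def cinner_scaleR_left)
      then show ?thesis
        unfolding sum using exp[OF that] scaleC_of_real[of 0 "e' m"] by simp
    qed
    moreover have "w = (\<Sum>i<Suc m. cinner (e' i) w *\<^sub>C e' i)"
    proof -
      have "cinner u w = cinner u u"
        by (subst w) (simp add: cinner_add_right u_span)
      then have "cinner (e' m) w = complex_of_real (norm u)"
        using False by (simp add: e'_def cinner_scaleR_left uu)
      then have "cinner (e' m) w *\<^sub>C e' m = u"
        using False by (simp add: scaleC_of_real e'_def)
      then show ?thesis unfolding sum using w by simp
    qed
    ultimately show ?thesis using e' by blast
  qed
qed

text \<open>The operator sends the first unit vectors of \<open>ell2\<close> to an orthonormal basis of the span of \<open>S\<close>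
and annihilates the others, so that \<open>W W'\<close> is the projection onto that span.\<close>

lemma partial_isometry_onto_finite_span:
  fixes S :: "'a::chilbert_space set"
  assumes "finite S"
  obtains W :: "ell2 \<Rightarrow>\<^sub>L 'a" and W' where
    "adjoint_pair W W'" "\<And>y. norm (W y) \<le> norm y" "\<And>v. v \<in> S \<Longrightarrow> W (W' v) = v"
proof -
  obtain m e where e: "orthonormal m e"
    and exp: "\<And>v. v \<in> S \<Longrightarrow> v = (\<Sum>i<m. cinner (e i) v *\<^sub>C e i)"
    using gram_schmidt[OF assms] by blast
  define W where "W = (\<Sum>i<m. rank_one (e i) (ell2_unit i))"
  define W' where "W' = (\<Sum>i<m. rank_one (ell2_unit i) (e i))"
  have adj: "adjoint_pair W W'"
    unfolding W_def W'_def by (intro adjoint_pair_sum adjoint_pair_rank_one)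
  have W: "W y = (\<Sum>i<m. cinner (ell2_unit i) y *\<^sub>C e i)" for y
    by (simp add: W_def blinfun.sum_left rank_one_apply)
  have WW': "W (W' v) = (\<Sum>i<m. cinner (e i) v *\<^sub>C e i)" for v
    unfolding W by (rule sum.cong)
      (simp_all add: W'_def blinfun.sum_left rank_one_apply orthonormal_coordinate[OF orthonormal_ell2_unit])
  have WW'W: "W (W' (W y)) = W y" for y
    unfolding WW' by (simp add: W[of y] orthonormal_coordinate[OF e])
  have "norm (W y) \<le> norm y" for y
  proof -
    have "W' (W y) \<bullet> W' (W y) = W y \<bullet> W y"
      using adjoint_pair_inner[OF adj, of "W' (W y)" "W y"] by (simp add: WW'W)
    then have n: "norm (W' (W y)) = norm (W y)" by (simp add: norm_eq)
    have "norm (W y) * norm (W y) = y \<bullet> W' (W y)"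
      using adjoint_pair_inner[OF adj, of y "W y"] by (simp add: dot_square_norm power2_eq_square)
    also have "\<dots> \<le> norm y * norm (W y)"
      using norm_cauchy_schwarz[of y "W' (W y)"] by (simp add: n)
    finally show ?thesis by (cases "W y = 0") auto
  qed
  with adj WW' exp show ?thesis using that by metis
qed

section \<open>Operator convexity on every Hilbert space\<close>

abbreviation op_power :: "('a::chilbert_space \<Rightarrow>\<^sub>L 'a) \<Rightarrow> nat \<Rightarrow> ('a \<Rightarrow>\<^sub>L 'a)" where
  "op_power A k \<equiv> ((o\<^sub>L) A ^^ k) id_blinfun"

text \<open>If \<open>W W'\<close> fixes the vectors \<open>x, A x, \<dots>\<close>, then \<open>W'\<close> carries each step from \<open>A\<^sup>k x\<close> to
\<open>A\<^sup>k\<^sup>+\<^sup>1 x\<close> over to the compressed operator \<open>W' A W\<close>.\<close>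

lemma poly_op_compression:
  fixes W :: "'b::chilbert_space \<Rightarrow>\<^sub>L 'a::chilbert_space" and W' :: "'a \<Rightarrow>\<^sub>L 'b"
  assumes fix_powers: "\<And>k. k \<le> degree q \<Longrightarrow> W (W' (op_power A k x)) = op_power A k x"
  shows "poly_op q (W' o\<^sub>L A o\<^sub>L W) (W' x) = W' (poly_op q A x)"
proof -
  have "op_power (W' o\<^sub>L A o\<^sub>L W) k (W' x) = W' (op_power A k x)" if "k \<le> degree q" for k
    using that by (induction k) (simp_all add: fix_powers)
  then show ?thesis
    by (simp add: poly_op_def blinfun.sum_left blinfun.sum_right blinfun.scaleR_left blinfun.scaleR_right)
qed

text \<open>A polynomial of degree \<open>d\<close> cannot distinguish \<open>A\<close> at \<open>x\<close> from its compression to a subspace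
that contains \<open>x, A x, \<dots>, A\<^sup>d x\<close>; so neither can, up to a small error, a function that is
uniformly close to such a polynomial.\<close>

lemma compression:
  fixes W :: "'b::chilbert_space \<Rightarrow>\<^sub>L 'a::chilbert_space"
  assumes W: "adjoint_pair W W'" "\<And>y. norm (W y) \<le> norm y"
    and A: "positive_op A" "norm A \<le> M"
  shows positive_op_compression: "positive_op (W' o\<^sub>L A o\<^sub>L W)"
    and spectrum_in_compression: "spectrum_in (W' o\<^sub>L A o\<^sub>L W) {0..M}"
    and fun_calc_compression: "continuous_on {0..M} f \<Longrightarrow> 0 \<le> d \<Longrightarrow>
      (\<And>t. t \<in> {0..M} \<Longrightarrow> \<bar>poly q t - f t\<bar> \<le> d) \<Longrightarrow>
      (\<And>k. k \<le> degree q \<Longrightarrow> W (W' (op_power A k x)) = op_power A k x) \<Longrightarrow>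
      \<bar>x \<bullet> fun_calc f A x - W' x \<bullet> fun_calc f (W' o\<^sub>L A o\<^sub>L W) (W' x)\<bar> \<le> 2 * d * (norm x)\<^sup>2"
proof -
  have M: "0 \<le> M" using A(2) norm_ge_zero[of A] by linarith
  show pos: "positive_op (W' o\<^sub>L A o\<^sub>L W)" by (rule positive_op_conj[OF W(1) A(1)])
  show spec: "spectrum_in (W' o\<^sub>L A o\<^sub>L W) {0..M}"
  proof (rule spectrum_in_quadratic_form_bounds)
    show "y \<bullet> (W' o\<^sub>L A o\<^sub>L W) y \<le> M * (norm y)\<^sup>2" for y
    proof -
      have "y \<bullet> (W' o\<^sub>L A o\<^sub>L W) y = W y \<bullet> A (W y)"
        by (simp add: adjoint_pair_inner[OF W(1)])
      also have "\<dots> \<le> norm A * (norm (W y))\<^sup>2" using quadratic_form_le_norm[of "W y" A] by simp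
      also have "\<dots> \<le> M * (norm y)\<^sup>2"
        using A(2) M W(2)[of y] by (intro mult_mono power_mono) auto
      finally show ?thesis .
    qed
  qed (use pos in \<open>auto simp: positive_op_iff\<close>)
  assume f: "continuous_on {0..M} f" and d: "0 \<le> d"
    and close: "\<And>t. t \<in> {0..M} \<Longrightarrow> \<bar>poly q t - f t\<bar> \<le> d"
    and fix_powers: "\<And>k. k \<le> degree q \<Longrightarrow> W (W' (op_power A k x)) = op_power A k x"
  have x: "W (W' x) = x" using fix_powers[of 0] by simp
  have norm_x: "norm (W' x) = norm x"
    using adjoint_pair_inner[OF W(1), of "W' x" x] by (simp add: x norm_eq)
  have err: "\<bar>y \<bullet> poly_op q B y - y \<bullet> fun_calc f B y\<bar> \<le> d * (norm y)\<^sup>2"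
    if "positive_op B" "spectrum_in B {0..M}" for B :: "'c::chilbert_space \<Rightarrow>\<^sub>L 'c" and y
  proof -
    have "norm (poly_op q B - fun_calc f B) \<le> d"
      using that by (intro fun_calc_poly_close[OF _ _ f d close]) (auto simp: positive_op_iff)
    from mult_right_mono[OF this, of "(norm y)\<^sup>2"] show ?thesis
      using quadratic_form_le_norm[of y "poly_op q B - fun_calc f B"]
      by (simp add: blinfun.diff_left inner_diff_right)
  qed
  have "W' x \<bullet> poly_op q (W' o\<^sub>L A o\<^sub>L W) (W' x) = W' x \<bullet> W' (poly_op q A x)"
    by (simp add: poly_op_compression[OF fix_powers])
  also have "\<dots> = x \<bullet> poly_op q A x"
    using adjoint_pair_inner[OF W(1), of "W' x" "poly_op q A x"] by (simp add: x)
  finally have eq: "W' x \<bullet> poly_op q (W' o\<^sub>L A o\<^sub>L W) (W' x) = x \<bullet> poly_op q A x" .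
  show "\<bar>x \<bullet> fun_calc f A x - W' x \<bullet> fun_calc f (W' o\<^sub>L A o\<^sub>L W) (W' x)\<bar> \<le> 2 * d * (norm x)\<^sup>2"
    using err[OF A(1) positive_op_spectrum[OF A], of x] err[OF pos spec, of "W' x"]
    by (simp add: eq norm_x)
qed

text \<open>For each vector \<open>x\<close>, the operators \<open>X\<close>, \<open>Y\<close> and their convex combination are compressed to \<open>ell2\<close>
by one and the same \<open>W\<close>. Compression preserves convex combinations, so the hypothesis on \<open>ell2\<close>
applies to the compressed operators.\<close>

lemma operator_convex_on_every_space:
  fixes X Y :: "'a::chilbert_space \<Rightarrow>\<^sub>L 'a"
  assumes f: "operator_convex {0..} f" and X: "positive_op X" and Y: "positive_op Y" and t: "t \<in> {0..1}"
  shows "fun_calc f (t *\<^sub>R X + (1 - t) *\<^sub>R Y) \<preceq> t *\<^sub>R fun_calc f X + (1 - t) *\<^sub>R fun_calc f Y"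
proof -
  define Z where "Z = t *\<^sub>R X + (1 - t) *\<^sub>R Y"
  define M where "M = max (norm X) (max (norm Y) (norm Z))"
  have Z: "positive_op Z"
    using t unfolding Z_def by (intro positive_op_add positive_op_scaleR X Y) auto
  have M: "norm X \<le> M" "norm Y \<le> M" "norm Z \<le> M" by (auto simp: M_def)
  have cont: "continuous_on {0..M} f"
    using f by (auto simp: operator_convex_def intro: continuous_on_subset)
  have sa: "selfadjoint (fun_calc f A)" if "positive_op A" "norm A \<le> M" for A :: "'a \<Rightarrow>\<^sub>L 'a"
    using that positive_op_spectrum[OF that]
    by (intro selfadjoint_fun_calc[OF _ _ cont]) (auto simp: positive_op_iff)
  have "fun_calc f Z \<preceq> t *\<^sub>R fun_calc f X + (1 - t) *\<^sub>R fun_calc f Y"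
  proof (rule op_leI)
    fix x :: 'a
    define Q where "Q A = x \<bullet> fun_calc f A x" for A
    have "Q Z \<le> t * Q X + (1 - t) * Q Y"
    proof (rule field_le_epsilon)
      fix \<epsilon> :: real assume \<epsilon>: "0 < \<epsilon>"
      \<comment> \<open>Both sides of the inequality change by at most \<open>2 d (norm x)\<^sup>2\<close> under compression.\<close>
      define d where "d = \<epsilon> / (4 * (norm x)\<^sup>2 + 4)"
      have d: "0 < d" using \<epsilon> by (simp add: d_def add_nonneg_pos)
      have "4 * d * (norm x)\<^sup>2 = \<epsilon> * ((4 * (norm x)\<^sup>2) / (4 * (norm x)\<^sup>2 + 4))" by (simp add: d_def)
      also have "\<dots> \<le> \<epsilon> * 1"
        using \<epsilon> by (intro mult_left_mono) (auto simp: divide_le_eq_1 add_nonneg_pos)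
      finally have d\<epsilon>: "4 * d * (norm x)\<^sup>2 \<le> \<epsilon>" by simp
      obtain p where "uniform_limit {0..M} (\<lambda>n. poly (p n)) f sequentially"
        using polynomials_uniformly_approximate[OF cont] by blast
      from uniform_limitD[OF this d] obtain N where "\<And>s. s \<in> {0..M} \<Longrightarrow> \<bar>poly (p N) s - f s\<bar> < d"
        unfolding eventually_sequentially dist_real_def by blast
      then obtain q where q: "\<And>s. s \<in> {0..M} \<Longrightarrow> \<bar>poly q s - f s\<bar> \<le> d"
        using less_imp_le by blast
      define S where "S = (\<lambda>(A, k). op_power A k x) ` ({X, Y, Z} \<times> {..degree q})"
      have "finite S" by (simp add: S_def)
      then obtain W :: "ell2 \<Rightarrow>\<^sub>L 'a" and W' where
        W: "adjoint_pair W W'" "\<And>y. norm (W y) \<le> norm y" and WS: "\<And>v. v \<in> S \<Longrightarrow> W (W' v) = v"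
        using partial_isometry_onto_finite_span by metis
      define comp where "comp A = W' o\<^sub>L A o\<^sub>L W" for A
      define \<xi> where "\<xi> = W' x"
      have fixed: "W (W' (op_power A k x)) = op_power A k x" if "A \<in> {X, Y, Z}" "k \<le> degree q" for A k
        using that by (intro WS) (force simp: S_def)
      have close: "\<bar>Q A - \<xi> \<bullet> fun_calc f (comp A) \<xi>\<bar> \<le> 2 * d * (norm x)\<^sup>2"
        and pos: "positive_op (comp A)" "spectrum_in (comp A) {0..M}"
        if A: "A \<in> {X, Y, Z}" for A
      proof -
        have "positive_op A" "norm A \<le> M" using A X Y Z M by auto
        note c = compression[OF W this]
        show "\<bar>Q A - \<xi> \<bullet> fun_calc f (comp A) \<xi>\<bar> \<le> 2 * d * (norm x)\<^sup>2"
          unfolding Q_def comp_def \<xi>_def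
          by (rule c(3)[OF cont less_imp_le[OF d] q fixed[OF A]])
        show "positive_op (comp A)" "spectrum_in (comp A) {0..M}"
          using c(1,2) by (simp_all add: comp_def)
      qed
      have compZ: "comp Z = t *\<^sub>R comp X + (1 - t) *\<^sub>R comp Y"
        unfolding comp_def Z_def by (rule blinfun_eqI) (simp add: blinfun.bilinear_simps)
      have spec0: "spectrum_in (comp A) {0..}" if "A \<in> {X, Y, Z}" for A
        using pos(2)[OF that] by force
      have "fun_calc f (comp Z) \<preceq> t *\<^sub>R fun_calc f (comp X) + (1 - t) *\<^sub>R fun_calc f (comp Y)"
        unfolding compZ
        using f t pos(1)[of X] pos(1)[of Y] spec0[of X] spec0[of Y]
        by (auto simp: operator_convex_def operator_convex_in_def positive_op_iff)
      from op_leD[OF this, of \<xi>]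
      have "\<xi> \<bullet> fun_calc f (comp Z) \<xi>
          \<le> t * (\<xi> \<bullet> fun_calc f (comp X) \<xi>) + (1 - t) * (\<xi> \<bullet> fun_calc f (comp Y) \<xi>)"
        by (simp add: blinfun.bilinear_simps inner_add_right)
      also have "\<dots> \<le> t * (Q X + 2 * d * (norm x)\<^sup>2) + (1 - t) * (Q Y + 2 * d * (norm x)\<^sup>2)"
        using close[of X] close[of Y] t by (intro add_mono mult_left_mono) auto
      also have "\<dots> = t * Q X + (1 - t) * Q Y + 2 * d * (norm x)\<^sup>2"
        by (simp add: algebra_simps)
      finally show "Q Z \<le> t * Q X + (1 - t) * Q Y + \<epsilon>"
        using close[of Z] d\<epsilon> by simp
    qed
    then show "x \<bullet> fun_calc f Z x \<le> x \<bullet> (t *\<^sub>R fun_calc f X + (1 - t) *\<^sub>R fun_calc f Y) x"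
      by (simp add: Q_def blinfun.bilinear_simps inner_add_right)
  qed (use sa X Y Z M in \<open>auto intro!: selfadjoint_add selfadjoint_scaleR\<close>)
  then show ?thesis by (simp add: Z_def)
qed

section \<open>Jensen's operator inequality\<close>

text \<open>Let \<open>P = C C'\<close> be the projection onto the range of the isometry \<open>C\<close>, and \<open>V = 2 P - 1\<close> the
reflection at this range. The midpoint of \<open>Z\<close> and \<open>V Z V\<close> leaves the range of \<open>C\<close> invariant, where it
acts as the compression \<open>P Z\<close>, while \<open>f\<close> of \<open>V Z V\<close> is \<open>V f(Z) V\<close>. So convexity at that midpoint,
restricted to the range of \<open>C\<close>, is the assertion.\<close>

lemma jensen_isometry:
  fixes Z :: "'b::chilbert_space \<Rightarrow>\<^sub>L 'b" and C :: "'a::chilbert_space \<Rightarrow>\<^sub>L 'b"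
  assumes f: "operator_convex {0..} f" and Z: "positive_op Z"
    and C: "adjoint_pair C C'" and isometry: "C' o\<^sub>L C = id_blinfun"
  shows "fun_calc f (C' o\<^sub>L Z o\<^sub>L C) \<preceq> C' o\<^sub>L fun_calc f Z o\<^sub>L C"
proof -
  define V where "V = 2 *\<^sub>R (C o\<^sub>L C') - id_blinfun"
  define Z' where "Z' = V o\<^sub>L Z o\<^sub>L V"
  define T where "T = (1/2) *\<^sub>R Z + (1/2) *\<^sub>R Z'"
  define M where "M = max (norm Z) (max (norm Z') (max (norm T) (norm (C' o\<^sub>L Z o\<^sub>L C))))"
  have C'C: "C' (C x) = x" for x
    using isometry by (metis blinfun_apply_blinfun_compose blinfun_apply_id_blinfun)
  have V_apply: "V y = 2 *\<^sub>R C (C' y) - y" for y by (simp add: V_def blinfun.bilinear_simps)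
  have V: "adjoint_pair V V"
    unfolding V_def by (intro adjoint_pair_intros adjoint_pair_sym[OF C] C)
  have VC: "V (C x) = C x" for x by (simp add: V_apply C'C flip: scaleR_left_distrib) (simp add: scaleR_2)
  have VV: "V (V y) = y" for y by (simp add: V_apply blinfun.bilinear_simps C'C scaleR_2)
  have Z': "positive_op Z'" unfolding Z'_def by (rule positive_op_conj[OF V Z])
  have T: "positive_op T" unfolding T_def by (intro positive_op_add positive_op_scaleR Z Z') auto
  have comp: "positive_op (C' o\<^sub>L Z o\<^sub>L C)" by (rule positive_op_conj[OF C Z])
  have cont: "continuous_on {0..M} f"
    using f by (auto simp: operator_convex_def intro: continuous_on_subset)
  have spec: "spectrum_in Z {0..M}" "spectrum_in Z' {0..M}" "spectrum_in T {0..M}"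
    "spectrum_in (C' o\<^sub>L Z o\<^sub>L C) {0..M}"
    by (intro positive_op_spectrum Z Z' T comp; simp add: M_def)+
  have sa: "selfadjoint Z" "selfadjoint Z'" "selfadjoint T" "selfadjoint (C' o\<^sub>L Z o\<^sub>L C)"
    using Z Z' T comp by (auto simp: positive_op_iff)
  have "Z' o\<^sub>L V = V o\<^sub>L Z" by (rule blinfun_eqI) (simp add: Z'_def VV)
  from fun_calc_intertwine[OF sa(2) spec(2) sa(1) spec(1) cont this]
  have fZ': "fun_calc f Z' (V y) = V (fun_calc f Z y)" for y
    by (metis blinfun_apply_blinfun_compose)
  have "T o\<^sub>L C = C o\<^sub>L (C' o\<^sub>L Z o\<^sub>L C)"
    by (rule blinfun_eqI)
      (simp add: T_def Z'_def VC V_apply[of "Z _"] blinfun.bilinear_simps algebra_simps)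
  from fun_calc_intertwine[OF sa(3) spec(3) sa(4) spec(4) cont this]
  have fT: "fun_calc f T (C x) = C (fun_calc f (C' o\<^sub>L Z o\<^sub>L C) x)" for x
    by (metis blinfun_apply_blinfun_compose)
  have midpoint: "fun_calc f T \<preceq> (1/2) *\<^sub>R fun_calc f Z + (1/2) *\<^sub>R fun_calc f Z'"
    using operator_convex_on_every_space[OF f Z Z', of "1/2"] by (simp add: T_def)
  show ?thesis
  proof (rule op_leI)
    fix x
    have "x \<bullet> fun_calc f (C' o\<^sub>L Z o\<^sub>L C) x = C x \<bullet> fun_calc f T (C x)"
      by (simp add: fT adjoint_pair_inner[OF C] C'C)
    also have "\<dots> \<le> (1/2) * (C x \<bullet> fun_calc f Z (C x)) + (1/2) * (C x \<bullet> fun_calc f Z' (C x))"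
      using op_leD[OF midpoint, of "C x"] by (simp add: blinfun.bilinear_simps inner_add_right)
    also have "C x \<bullet> fun_calc f Z' (C x) = C x \<bullet> fun_calc f Z (C x)"
      using fZ'[of "C x"] adjoint_pair_inner[OF V, of "C x" "fun_calc f Z (C x)"] by (simp add: VC)
    finally show "x \<bullet> fun_calc f (C' o\<^sub>L Z o\<^sub>L C) x \<le> x \<bullet> (C' o\<^sub>L fun_calc f Z o\<^sub>L C) x"
      by (simp add: adjoint_pair_inner[OF C])
  next
    show "selfadjoint (fun_calc f (C' o\<^sub>L Z o\<^sub>L C))"
      by (rule selfadjoint_fun_calc[OF sa(4) spec(4) cont])
    show "selfadjoint (C' o\<^sub>L fun_calc f Z o\<^sub>L C)"
      by (rule selfadjoint_conj[OF C selfadjoint_fun_calc[OF sa(1) spec(1) cont]])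
  qed
qed

instantiation prod :: (chilbert_space, chilbert_space) chilbert_space
begin

definition scaleC_prod :: "complex \<Rightarrow> 'a \<times> 'b \<Rightarrow> 'a \<times> 'b" where
  "scaleC_prod c x = (c *\<^sub>C fst x, c *\<^sub>C snd x)"

definition cinner_prod :: "'a \<times> 'b \<Rightarrow> 'a \<times> 'b \<Rightarrow> complex" where
  "cinner_prod x y = cinner (fst x) (fst y) + cinner (snd x) (snd y)"

instance
proof
  fix x y :: "'a \<times> 'b"
  show "cinner x y = cnj (cinner y x)"
    by (simp add: cinner_prod_def flip: cinner_commute)
qed (auto simp: scaleC_prod_def cinner_prod_def inner_prod_def scaleC_of_real scaleC_add_right
    scaleC_add_left scaleC_scaleC cinner_add_left cinner_scaleC_left inner_eq_Re_cinner
    prod_eq_iff algebra_simps)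

end

text \<open>The two-term inequality is the one for the isometry \<open>x \<mapsto> (A x, B x)\<close> and the diagonal operator
with entries \<open>X\<close> and \<open>Y\<close>, for which the functional calculus acts entrywise.\<close>

lemma jensen_pair:
  fixes X Y A B :: "'a::chilbert_space \<Rightarrow>\<^sub>L 'a"
  assumes f: "operator_convex {0..} f" and X: "positive_op X" and Y: "positive_op Y"
    and A: "adjoint_pair A A'" and B: "adjoint_pair B B'"
    and unital: "(A' o\<^sub>L A) + (B' o\<^sub>L B) = id_blinfun"
  shows "fun_calc f ((A' o\<^sub>L X o\<^sub>L A) + (B' o\<^sub>L Y o\<^sub>L B))
    \<preceq> (A' o\<^sub>L fun_calc f X o\<^sub>L A) + (B' o\<^sub>L fun_calc f Y o\<^sub>L B)"
proof -
  define \<iota>\<^sub>1 :: "'a \<Rightarrow>\<^sub>L ('a \<times> 'a)" where "\<iota>\<^sub>1 = Blinfun (\<lambda>x. (x, 0))"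
  define \<iota>\<^sub>2 :: "'a \<Rightarrow>\<^sub>L ('a \<times> 'a)" where "\<iota>\<^sub>2 = Blinfun (\<lambda>x. (0, x))"
  have \<iota> [simp]: "\<iota>\<^sub>1 x = (x, 0)" "\<iota>\<^sub>2 x = (0, x)" for x
    by (simp_all add: \<iota>\<^sub>1_def \<iota>\<^sub>2_def bounded_linear_Blinfun_apply bounded_linear_intros bounded_linear_Pair)
  have adj: "adjoint_pair \<iota>\<^sub>1 fst_blinfun" "adjoint_pair \<iota>\<^sub>2 snd_blinfun"
    by (simp_all add: adjoint_pair_def cinner_prod_def)
  define Z where "Z = (\<iota>\<^sub>1 o\<^sub>L X o\<^sub>L fst_blinfun) + (\<iota>\<^sub>2 o\<^sub>L Y o\<^sub>L snd_blinfun)"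
  define C where "C = (\<iota>\<^sub>1 o\<^sub>L A) + (\<iota>\<^sub>2 o\<^sub>L B)"
  define C' where "C' = (A' o\<^sub>L fst_blinfun) + (B' o\<^sub>L snd_blinfun)"
  have Z: "positive_op Z"
    unfolding Z_def
    by (intro positive_op_add positive_op_conj[OF adjoint_pair_sym[OF adj(1)] X]
        positive_op_conj[OF adjoint_pair_sym[OF adj(2)] Y])
  have C: "adjoint_pair C C'"
    unfolding C_def C'_def by (intro adjoint_pair_add adjoint_pair_compose adj A B)
  have "A' (A x) + B' (B x) = x" for x
    using unital by (metis blinfun.add_left blinfun_apply_blinfun_compose blinfun_apply_id_blinfun)
  then have isometry: "C' o\<^sub>L C = id_blinfun"
    by (intro blinfun_eqI) (simp add: C_def C'_def blinfun.bilinear_simps)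
  define M where "M = max (norm Z) (max (norm X) (norm Y))"
  have cont: "continuous_on {0..M} f"
    using f by (auto simp: operator_convex_def intro: continuous_on_subset)
  have spec: "spectrum_in X {0..M}" "spectrum_in Y {0..M}" "spectrum_in Z {0..M}"
    by (intro positive_op_spectrum X Y Z; simp add: M_def)+
  have sa: "selfadjoint X" "selfadjoint Y" "selfadjoint Z"
    using X Y Z by (auto simp: positive_op_iff)
  have Z\<iota>: "Z o\<^sub>L \<iota>\<^sub>1 = \<iota>\<^sub>1 o\<^sub>L X" "Z o\<^sub>L \<iota>\<^sub>2 = \<iota>\<^sub>2 o\<^sub>L Y"
    by (rule blinfun_eqI, simp add: Z_def blinfun.bilinear_simps)+
  have f\<iota>: "fun_calc f Z (\<iota>\<^sub>1 x) = \<iota>\<^sub>1 (fun_calc f X x)" "fun_calc f Z (\<iota>\<^sub>2 x) = \<iota>\<^sub>2 (fun_calc f Y x)" for x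
    using fun_calc_intertwine[OF sa(3) spec(3) sa(1) spec(1) cont Z\<iota>(1)]
      fun_calc_intertwine[OF sa(3) spec(3) sa(2) spec(2) cont Z\<iota>(2)]
    by (metis blinfun_apply_blinfun_compose)+
  have C_apply: "C x = \<iota>\<^sub>1 (A x) + \<iota>\<^sub>2 (B x)" for x
    by (simp add: C_def blinfun.bilinear_simps)
  have "C' o\<^sub>L Z o\<^sub>L C = (A' o\<^sub>L X o\<^sub>L A) + (B' o\<^sub>L Y o\<^sub>L B)"
    by (rule blinfun_eqI) (simp add: C_def C'_def Z_def blinfun.bilinear_simps)
  moreover have "C' o\<^sub>L fun_calc f Z o\<^sub>L C
      = (A' o\<^sub>L fun_calc f X o\<^sub>L A) + (B' o\<^sub>L fun_calc f Y o\<^sub>L B)"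
  proof (rule blinfun_eqI)
    fix x
    have "fun_calc f Z (C x) = (fun_calc f X (A x), fun_calc f Y (B x))"
      unfolding C_apply blinfun.add_right f\<iota> by simp
    then show "(C' o\<^sub>L fun_calc f Z o\<^sub>L C) x
        = ((A' o\<^sub>L fun_calc f X o\<^sub>L A) + (B' o\<^sub>L fun_calc f Y o\<^sub>L B)) x"
      by (simp add: C'_def blinfun.bilinear_simps)
  qed
  ultimately show ?thesis
    using jensen_isometry[OF f Z C isometry] by simp
qed

section \<open>Joint convexity and homogeneity of the perspective\<close>

lemma strictly_positive_add:
  assumes "positive_op A" "strictly_positive B"
  shows "strictly_positive (A + B)"
proof -
  obtain m where m: "0 < m" "\<And>x. m * (norm x)\<^sup>2 \<le> x \<bullet> B x"
    using assms(2) by (auto simp: strictly_positive_iff)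
  have "m * (norm x)\<^sup>2 \<le> x \<bullet> (A + B) x" for x
    using m(2)[of x] assms(1) by (simp add: positive_op_iff blinfun.add_left inner_add_right add_increasing)
  with m(1) assms show ?thesis
    by (auto simp: strictly_positive_iff positive_op_iff intro: selfadjoint_add)
qed

lemma strictly_positive_scaleR:
  assumes r: "0 < r" and A: "strictly_positive A"
  shows "strictly_positive (r *\<^sub>R A)"
proof -
  obtain m where m: "0 < m" "\<And>x. m * (norm x)\<^sup>2 \<le> x \<bullet> A x"
    using A by (auto simp: strictly_positive_iff)
  have "(r * m) * (norm x)\<^sup>2 \<le> x \<bullet> (r *\<^sub>R A) x" for x
    using mult_left_mono[OF m(2)[of x], of r] r by (simp add: blinfun.scaleR_left mult.assoc)
  moreover have "0 < r * m" using r m(1) by simp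
  ultimately show ?thesis
    using A by (auto simp: strictly_positive_iff intro: selfadjoint_scaleR)
qed

text \<open>With \<open>R = p R\<^sub>0 + q R\<^sub>1\<close>, apply Jensen's inequality to \<open>A = p\<^sup>1\<^sup>/\<^sup>2 R\<^sub>0\<^sup>1\<^sup>/\<^sup>2 R\<^sup>-\<^sup>1\<^sup>/\<^sup>2\<close> and
\<open>B = q\<^sup>1\<^sup>/\<^sup>2 R\<^sub>1\<^sup>1\<^sup>/\<^sup>2 R\<^sup>-\<^sup>1\<^sup>/\<^sup>2\<close>, for which \<open>A' A + B' B = R\<^sup>-\<^sup>1\<^sup>/\<^sup>2 R R\<^sup>-\<^sup>1\<^sup>/\<^sup>2 = 1\<close>, and multiply by
\<open>R\<^sup>1\<^sup>/\<^sup>2\<close> on both sides. As the weights \<open>p\<close> and \<open>q\<close> are arbitrary nonnegative numbers, homogeneity in the form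
\<open>g (p L, p R) \<le> p g (L, R)\<close> is included.\<close>

lemma perspective_jointly_convex:
  fixes L\<^sub>0 L\<^sub>1 R\<^sub>0 R\<^sub>1 :: "'a::chilbert_space \<Rightarrow>\<^sub>L 'a"
  assumes f: "operator_convex {0..} f"
    and L: "positive_op L\<^sub>0" "positive_op L\<^sub>1" and R: "strictly_positive R\<^sub>0" "strictly_positive R\<^sub>1"
    and pq: "0 \<le> p" "0 \<le> q" and sum: "strictly_positive (p *\<^sub>R R\<^sub>0 + q *\<^sub>R R\<^sub>1)"
  shows "perspective f (p *\<^sub>R L\<^sub>0 + q *\<^sub>R L\<^sub>1) (p *\<^sub>R R\<^sub>0 + q *\<^sub>R R\<^sub>1)
    \<preceq> p *\<^sub>R perspective f L\<^sub>0 R\<^sub>0 + q *\<^sub>R perspective f L\<^sub>1 R\<^sub>1"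
proof -
  define S where "S = powr_op (p *\<^sub>R R\<^sub>0 + q *\<^sub>R R\<^sub>1) (1/2)"
  define N where "N = powr_op (p *\<^sub>R R\<^sub>0 + q *\<^sub>R R\<^sub>1) (-1/2)"
  define S\<^sub>0 S\<^sub>1 where "S\<^sub>0 = powr_op R\<^sub>0 (1/2)" and "S\<^sub>1 = powr_op R\<^sub>1 (1/2)"
  define N\<^sub>0 N\<^sub>1 where "N\<^sub>0 = powr_op R\<^sub>0 (-1/2)" and "N\<^sub>1 = powr_op R\<^sub>1 (-1/2)"
  define X where "X = N\<^sub>0 o\<^sub>L L\<^sub>0 o\<^sub>L N\<^sub>0"
  define Y where "Y = N\<^sub>1 o\<^sub>L L\<^sub>1 o\<^sub>L N\<^sub>1"
  define A where "A = sqrt p *\<^sub>R (S\<^sub>0 o\<^sub>L N)"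
  define A' where "A' = sqrt p *\<^sub>R (N o\<^sub>L S\<^sub>0)"
  define B where "B = sqrt q *\<^sub>R (S\<^sub>1 o\<^sub>L N)"
  define B' where "B' = sqrt q *\<^sub>R (N o\<^sub>L S\<^sub>1)"
  have adj: "adjoint_pair S S" "adjoint_pair N N" "adjoint_pair S\<^sub>0 S\<^sub>0" "adjoint_pair N\<^sub>0 N\<^sub>0"
    "adjoint_pair S\<^sub>1 S\<^sub>1" "adjoint_pair N\<^sub>1 N\<^sub>1"
    unfolding S_def N_def S\<^sub>0_def S\<^sub>1_def N\<^sub>0_def N\<^sub>1_def
    by (simp_all add: selfadjoint_powr_op R sum flip: selfadjoint_iff_adjoint_pair)
  have pw: "F (G x) = H x" if "F o\<^sub>L G = H" for F G H :: "'a \<Rightarrow>\<^sub>L 'a" and x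
    using that by auto
  have S: "S (S x) = p *\<^sub>R R\<^sub>0 x + q *\<^sub>R R\<^sub>1 x" "N (S x) = x" "S (N x) = x" for x
    using pw[OF powr_op_half_square[OF sum], of x] pw[OF powr_op_half_inverse_left[OF sum], of x]
      pw[OF powr_op_half_inverse_right[OF sum], of x]
    by (simp_all add: S_def N_def blinfun.bilinear_simps)
  have S\<^sub>0: "S\<^sub>0 (S\<^sub>0 x) = R\<^sub>0 x" "N\<^sub>0 (S\<^sub>0 x) = x" "S\<^sub>0 (N\<^sub>0 x) = x" for x
    using pw[OF powr_op_half_square[OF R(1)], of x] pw[OF powr_op_half_inverse_left[OF R(1)], of x]
      pw[OF powr_op_half_inverse_right[OF R(1)], of x]
    by (simp_all add: S\<^sub>0_def N\<^sub>0_def)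
  have S\<^sub>1: "S\<^sub>1 (S\<^sub>1 x) = R\<^sub>1 x" "N\<^sub>1 (S\<^sub>1 x) = x" "S\<^sub>1 (N\<^sub>1 x) = x" for x
    using pw[OF powr_op_half_square[OF R(2)], of x] pw[OF powr_op_half_inverse_left[OF R(2)], of x]
      pw[OF powr_op_half_inverse_right[OF R(2)], of x]
    by (simp_all add: S\<^sub>1_def N\<^sub>1_def)
  have XY: "positive_op X" "positive_op Y"
    unfolding X_def Y_def by (intro positive_op_conj adj L)+
  have AB: "adjoint_pair A A'" "adjoint_pair B B'"
    unfolding A_def A'_def B_def B'_def by (intro adjoint_pair_intros adj)+
  have sq: "sqrt p *\<^sub>R sqrt p *\<^sub>R x = p *\<^sub>R x" "sqrt q *\<^sub>R sqrt q *\<^sub>R x = q *\<^sub>R x" for x :: 'a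
    using pq by simp_all
  have unital: "(A' o\<^sub>L A) + (B' o\<^sub>L B) = id_blinfun"
  proof (rule blinfun_eqI)
    fix x
    have "((A' o\<^sub>L A) + (B' o\<^sub>L B)) x = N (p *\<^sub>R R\<^sub>0 (N x) + q *\<^sub>R R\<^sub>1 (N x))"
      unfolding A_def A'_def B_def B'_def
      by (simp add: blinfun.bilinear_simps S\<^sub>0 S\<^sub>1 sq del: scaleR_scaleR)
    also have "\<dots> = x" unfolding S(1)[symmetric] by (simp add: S)
    finally show "((A' o\<^sub>L A) + (B' o\<^sub>L B)) x = id_blinfun x" by simp
  qed
  have arg: "(A' o\<^sub>L X o\<^sub>L A) + (B' o\<^sub>L Y o\<^sub>L B) = N o\<^sub>L (p *\<^sub>R L\<^sub>0 + q *\<^sub>R L\<^sub>1) o\<^sub>L N"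
    unfolding A_def A'_def B_def B'_def X_def Y_def
    by (rule blinfun_eqI) (simp add: blinfun.bilinear_simps S\<^sub>0 S\<^sub>1 sq del: scaleR_scaleR)
  have "S o\<^sub>L fun_calc f ((A' o\<^sub>L X o\<^sub>L A) + (B' o\<^sub>L Y o\<^sub>L B)) o\<^sub>L S
      \<preceq> S o\<^sub>L ((A' o\<^sub>L fun_calc f X o\<^sub>L A) + (B' o\<^sub>L fun_calc f Y o\<^sub>L B)) o\<^sub>L S"
    by (rule op_le_conj[OF adj(1) jensen_pair[OF f XY AB unital]])
  also have "S o\<^sub>L fun_calc f ((A' o\<^sub>L X o\<^sub>L A) + (B' o\<^sub>L Y o\<^sub>L B)) o\<^sub>L S
      = perspective f (p *\<^sub>R L\<^sub>0 + q *\<^sub>R L\<^sub>1) (p *\<^sub>R R\<^sub>0 + q *\<^sub>R R\<^sub>1)"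
    unfolding arg by (simp add: perspective_def S_def N_def)
  also have "S o\<^sub>L ((A' o\<^sub>L fun_calc f X o\<^sub>L A) + (B' o\<^sub>L fun_calc f Y o\<^sub>L B)) o\<^sub>L S
      = p *\<^sub>R (S\<^sub>0 o\<^sub>L fun_calc f X o\<^sub>L S\<^sub>0) + q *\<^sub>R (S\<^sub>1 o\<^sub>L fun_calc f Y o\<^sub>L S\<^sub>1)"
    unfolding A_def A'_def B_def B'_def
    by (rule blinfun_eqI) (simp add: blinfun.bilinear_simps S sq del: scaleR_scaleR)
  also have "S\<^sub>0 o\<^sub>L fun_calc f X o\<^sub>L S\<^sub>0 = perspective f L\<^sub>0 R\<^sub>0"
    by (simp add: perspective_def S\<^sub>0_def N\<^sub>0_def X_def)
  also have "S\<^sub>1 o\<^sub>L fun_calc f Y o\<^sub>L S\<^sub>1 = perspective f L\<^sub>1 R\<^sub>1"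
    by (simp add: perspective_def S\<^sub>1_def N\<^sub>1_def Y_def)
  finally show ?thesis .
qed

lemma strictly_positive_sum:
  assumes "finite J" "J \<noteq> {}" "\<And>j. j \<in> J \<Longrightarrow> strictly_positive (A j)"
  shows "strictly_positive (\<Sum>j\<in>J. A j)"
  using assms by (induction rule: finite_ne_induct)
    (auto intro!: strictly_positive_add simp: strictly_positive_def[of "A _"])

text \<open>The operator \<open>R\<^sup>-\<^sup>1\<^sup>/\<^sup>2 L R\<^sup>-\<^sup>1\<^sup>/\<^sup>2\<close> to which \<open>f\<close> is applied is congruent to \<open>L\<close>, so the condition on its
spectrum amounts to \<open>0 \<le> L\<close>. In this form it is inherited by sums with positive weights.\<close>

lemma positive_op_of_perspective_domain:
  assumes L: "selfadjoint L" and R: "strictly_positive R"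
    and dom: "spectrum_in (powr_op R (-1/2) o\<^sub>L L o\<^sub>L powr_op R (-1/2)) {0..}"
  shows "positive_op L"
proof -
  define S where "S = powr_op R (1/2)"
  define N where "N = powr_op R (-1/2)"
  have adj: "adjoint_pair S S" "adjoint_pair N N"
    by (simp_all add: S_def N_def selfadjoint_powr_op[OF R] flip: selfadjoint_iff_adjoint_pair)
  have inv: "S o\<^sub>L N = id_blinfun" "N o\<^sub>L S = id_blinfun"
    unfolding S_def N_def by (rule powr_op_half_inverse_right[OF R] powr_op_half_inverse_left[OF R])+
  have "positive_op (N o\<^sub>L L o\<^sub>L N)"
    by (rule spectrum_nonneg_imp_positive_op[OF selfadjoint_conj[OF adj(2) L]])
      (rule dom[folded N_def])
  from positive_op_conj[OF adj(1) this] have "positive_op (S o\<^sub>L (N o\<^sub>L L o\<^sub>L N) o\<^sub>L S)" .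
  also have "S o\<^sub>L (N o\<^sub>L L o\<^sub>L N) o\<^sub>L S = (S o\<^sub>L N) o\<^sub>L L o\<^sub>L (N o\<^sub>L S)"
    by (simp only: blinfun_compose_assoc)
  finally show ?thesis by (simp add: inv)
qed

lemma perspective_sum_le:
  fixes L R :: "'i \<Rightarrow> 'a::chilbert_space \<Rightarrow>\<^sub>L 'a"
  assumes f: "operator_convex {0..} f" and "finite J" "J \<noteq> {}"
    and "\<And>j. j \<in> J \<Longrightarrow> 0 < p j" "\<And>j. j \<in> J \<Longrightarrow> positive_op (L j)"
    and "\<And>j. j \<in> J \<Longrightarrow> strictly_positive (R j)"
  shows "perspective f (\<Sum>j\<in>J. p j *\<^sub>R L j) (\<Sum>j\<in>J. p j *\<^sub>R R j) \<preceq> (\<Sum>j\<in>J. p j *\<^sub>R perspective f (L j) (R j))"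
  using assms(2-)
proof (induction rule: finite_ne_induct)
  case (singleton j)
  \<comment> \<open>Homogeneity: joint convexity with the weights \<open>p j\<close> and \<open>0\<close>.\<close>
  then show ?case
    using perspective_jointly_convex[OF f, of "L j" "L j" "R j" "R j" "p j" 0]
    by (simp add: strictly_positive_scaleR)
next
  case (insert j J)
  let ?L = "\<Sum>i\<in>J. p i *\<^sub>R L i" and ?R = "\<Sum>i\<in>J. p i *\<^sub>R R i"
  have pL: "positive_op ?L"
    using insert.prems by (intro positive_op_sum positive_op_scaleR) (auto intro: less_imp_le)
  have pR: "strictly_positive ?R"
    using insert by (intro strictly_positive_sum strictly_positive_scaleR) auto
  have pos: "0 < p j" "positive_op (L j)" "strictly_positive (R j)"
    using insert.prems by auto
  then have "strictly_positive (p j *\<^sub>R R j + 1 *\<^sub>R ?R)"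
    using pR by (auto intro!: strictly_positive_add positive_op_scaleR simp: strictly_positive_def[of "R j"])
  from perspective_jointly_convex[OF f pos(2) pL pos(3) pR _ _ this]
  have "perspective f (p j *\<^sub>R L j + ?L) (p j *\<^sub>R R j + ?R)
      \<preceq> p j *\<^sub>R perspective f (L j) (R j) + perspective f ?L ?R"
    using pos(1) by simp
  from op_le_trans[OF this op_le_add[OF op_le_refl insert.IH]] insert
  show ?case by simp
qed

theorem theorem2p4:
  fixes f :: "real \<Rightarrow> real"
    and n :: nat
    and p :: "nat \<Rightarrow> real"
    and L R :: "nat \<Rightarrow> nat \<Rightarrow> 'a::chilbert_space \<Rightarrow>\<^sub>L 'a"
  assumes f: "operator_convex {0..} f"
    and p: "\<And>j. j \<in> {1..n} \<Longrightarrow> 0 < p j"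
    and L: "\<And>i j. i \<in> {1..n} \<Longrightarrow> j \<in> {1..n} \<Longrightarrow> selfadjoint (L i j)"
    and R: "\<And>i j. i \<in> {1..n} \<Longrightarrow> j \<in> {1..n} \<Longrightarrow> strictly_positive (R i j)"
    and dom: "\<And>i j. i \<in> {1..n} \<Longrightarrow> j \<in> {1..n} \<Longrightarrow>
      spectrum_in (powr_op (R i j) (-1/2) o\<^sub>L L i j o\<^sub>L powr_op (R i j) (-1/2)) {0..}"
  shows "(\<Sum>i\<in>{1..n}. perspective f (\<Sum>j\<in>{1..n}. p j *\<^sub>R L i j) (\<Sum>j\<in>{1..n}. p j *\<^sub>R R i j))
    \<preceq> (\<Sum>i\<in>{1..n}. p i *\<^sub>R f_divergence f n (\<lambda>k. L k i) (\<lambda>k. R k i))"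
proof -
  have Lpos: "positive_op (L i j)" if "i \<in> {1..n}" "j \<in> {1..n}" for i j
    by (rule positive_op_of_perspective_domain[OF L[OF that] R[OF that] dom[OF that]])
  have "(\<Sum>i\<in>{1..n}. perspective f (\<Sum>j\<in>{1..n}. p j *\<^sub>R L i j) (\<Sum>j\<in>{1..n}. p j *\<^sub>R R i j))
      \<preceq> (\<Sum>i\<in>{1..n}. \<Sum>j\<in>{1..n}. p j *\<^sub>R perspective f (L i j) (R i j))"
    by (intro op_le_sum perspective_sum_le f p Lpos R) auto
  also have "(\<Sum>i\<in>{1..n}. \<Sum>j\<in>{1..n}. p j *\<^sub>R perspective f (L i j) (R i j))
      = (\<Sum>j\<in>{1..n}. p j *\<^sub>R (\<Sum>i\<in>{1..n}. perspective f (L i j) (R i j)))"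
    by (subst sum.swap) (simp add: scaleR_sum_right)
  finally show ?thesis
    by (simp add: f_divergence_def perspective_def)
qed

end
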